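(* For every integer $n\ge3$, $$\left(\frac{\operatorname{Vol}\widetilde{\mathrm{Sos}}^{(n)}_{\mathcal Q}}{\operatorname{Vol}B_{\mathcal M}}\right)^{1/D_{\mathcal M}}\le 2^{3}\cdot3\cdot6^{1/2}\cdot\frac1n.$$
   Context: Let $x=(x_1,\dots,x_n)$, $y=(y_1,\dots,y_n)$ be tuples of commuting variables, $\mathbb R[x,y]_{k_1,k_2}$ the space of polynomials homogeneous of degree $k_1$ in $x$ and of degree $k_2$ in $y$, $I\subseteq\mathbb R[x,y]$ the ideal generated by $\sum_{i=1}^n x_iy_i$, and $V(I)=\{(x,y)\in\mathbb R^n\times\mathbb R^n: y^Tx=0\}$. Put $\mathcal Q=\mathbb R[x,y]_{2,2}/(I\cap\mathbb R[x,y]_{2,2})$; elements of $\mathcal Q$ are functions on $V(I)$. Let $\mathrm{Sos}^{(n)}_{\mathcal Q}=\{p\in\mathcal Q: p-\sum_{i=1}^k p_i^2\in I\text{ for some }k\in\mathbb N,\ p_i\in\mathbb R[x,y]_{1,1}\}$. Let $T=(\mathbb S^{n-1}\times \mathbb S^{n-1})\cap V(I)$ be the set of pairs of orthonormal vectors in $\mathbb R^n$, and let $\sigma$ be the unique normalized (total mass $1$) Borel measure on $T$ invariant under the action $g(x,y)=(gx,gy)$ of $SO(n)$. Let $\mathcal H=\{f\in\mathcal Q:\int_T f\,d\sigma=1\}$, $\mathcal M=\{f\in\mathcal Q:\int_T f\,d\sigma=0\}$, and $\widetilde{\mathrm{Sos}}^{(n)}_{\mathcal Q}=\{f\in\mathcal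 Q: f+(\sum_i x_i^2)(\sum_i y_i^2)\in \mathrm{Sos}^{(n)}_{\mathcal Q}\cap\mathcal H\}\subseteq\mathcal M$. $\mathcal M$ carries the inner product $\langle f,g\rangle=\int_T fg\,d\sigma$, has dimension $D_{\mathcal M}=\binom{n+1}{2}^2-n^2-1$, and $B_{\mathcal M}$ is its unit ball. $\operatorname{Vol}$ denotes the pushforward to $\mathcal M$ of Lebesgue measure on $\mathbb R^{D_{\mathcal M}}$ under any linear isometry $\mathbb R^{D_{\mathcal M}}\to\mathcal M$ (independent of the choice). *)

theory Defs
  imports "HOL-Probability.Probability_Measure" "HOL-Library.Poly_Mapping"
    "HOL-Analysis.Finite_Function_Topology"
begin

section \<open>The polynomial ring and the ideal\<close>

text \<open>
  The index type \<open>'n\<close> has \<open>n\<close> elements. The variables are indexed by \<open>'n + 'n\<close>, where \<open>Inl i\<close>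
  stands for \<open>x\<^sub>i\<close> and \<open>Inr i\<close> for \<open>y\<^sub>i\<close>; a polynomial is a finitely supported map from monomials
  (exponent vectors) to coefficients, with the convolution product of \<^theory>\<open>HOL-Library.Poly_Mapping\<close>.
\<close>

type_synonym 'n xypoly = "('n + 'n \<Rightarrow>\<^sub>0 nat) \<Rightarrow>\<^sub>0 real"

definition var_x :: "'n \<Rightarrow> 'n xypoly" where
  "var_x i = Poly_Mapping.single (Poly_Mapping.single (Inl i) 1) 1"

definition var_y :: "'n \<Rightarrow> 'n xypoly" where
  "var_y i = Poly_Mapping.single (Poly_Mapping.single (Inr i) 1) 1"

definition bihom :: "nat \<Rightarrow> nat \<Rightarrow> ('n::finite) xypoly set" where
  "bihom k1 k2 = {p. \<forall>m\<in>Poly_Mapping.keys p.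
     (\<Sum>i\<in>UNIV. Poly_Mapping.lookup m (Inl i)) = k1 \<and>
     (\<Sum>i\<in>UNIV. Poly_Mapping.lookup m (Inr i)) = k2}"

definition ideal_I :: "('n::finite) xypoly set" where
  "ideal_I = {q * (\<Sum>i\<in>UNIV. var_x i * var_y i) |q. True}"

definition variety_I :: "((real^'n) \<times> (real^'n)) set" where
  "variety_I = {(x, y). y \<bullet> x = 0}"

definition monom_eval :: "('n::finite + 'n \<Rightarrow>\<^sub>0 nat) \<Rightarrow> (real^'n) \<times> (real^'n) \<Rightarrow> real" where
  "monom_eval m z = (\<Prod>i\<in>UNIV. fst z $ i ^ Poly_Mapping.lookup m (Inl i)) *
                    (\<Prod>i\<in>UNIV. snd z $ i ^ Poly_Mapping.lookup m (Inr i))"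

definition poly_eval :: "('n::finite) xypoly \<Rightarrow> (real^'n) \<times> (real^'n) \<Rightarrow> real" where
  "poly_eval p z = (\<Sum>m\<in>Poly_Mapping.keys p. Poly_Mapping.lookup p m * monom_eval m z)"

lemma lookup_scaleR_poly: "Poly_Mapping.lookup (c *\<^sub>R p) m = c *\<^sub>R Poly_Mapping.lookup p m"
proof -
  have "finite {i. c *\<^sub>R Poly_Mapping.lookup p i \<noteq> 0}"
    by (rule finite_subset[OF _ finite_lookup[of p]]) auto
  then show ?thesis
    by (simp add: scaleR_poly_mapping_def)
qed

lemma scaleR_poly_mult: "c *\<^sub>R (p * q) = (c *\<^sub>R p) * (q :: 'n xypoly)"
proof -
  have *: "c *\<^sub>R p = Poly_Mapping.single 0 c * p" for p :: "'n xypoly"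
  proof -
    have "c *\<^sub>R p = Poly_Mapping.map ((*) c) p"
      by (rule poly_mapping_eqI) (simp add: lookup_scaleR_poly map.rep_eq when_def)
    then show ?thesis by (simp add: mult_map_scale_conv_mult)
  qed
  show ?thesis unfolding * by (simp add: mult.assoc)
qed

subsection \<open>Closure properties\<close>

lemma bihom_0: "0 \<in> bihom k1 k2"
  by (simp add: bihom_def)

lemma bihom_add: "p \<in> bihom k1 k2 \<Longrightarrow> q \<in> bihom k1 k2 \<Longrightarrow> p + q \<in> bihom k1 k2"
  unfolding bihom_def using Poly_Mapping.keys_add[of p q] by blast

lemma bihom_scaleR: "p \<in> bihom k1 k2 \<Longrightarrow> c *\<^sub>R p \<in> bihom k1 k2"
  by (auto simp: bihom_def in_keys_iff lookup_scaleR_poly)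

lemma bihom_uminus: "p \<in> bihom k1 k2 \<Longrightarrow> - p \<in> bihom k1 k2"
  by (auto simp: bihom_def in_keys_iff)

lemma bihom_diff: "p \<in> bihom k1 k2 \<Longrightarrow> q \<in> bihom k1 k2 \<Longrightarrow> p - q \<in> bihom k1 k2"
  using bihom_add[OF _ bihom_uminus, of p k1 k2 q] by simp

lemma bihom_sum: "(\<And>i. i \<in> A \<Longrightarrow> f i \<in> bihom k1 k2) \<Longrightarrow> sum f A \<in> bihom k1 k2"
  by (induction A rule: infinite_finite_induct) (auto simp: bihom_0 bihom_add)

lemma bihom_mult:
  assumes "p \<in> bihom k1 k2" "q \<in> bihom l1 l2"
  shows "p * q \<in> bihom (k1 + l1) (k2 + l2)"
  unfolding bihom_def
proof (rule CollectI, rule ballI)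
  fix m assume "m \<in> Poly_Mapping.keys (p * q)"
  then obtain a b where "m = a + b" "a \<in> Poly_Mapping.keys p" "b \<in> Poly_Mapping.keys q"
    using Poly_Mapping.keys_mult[of p q] by blast
  then show "(\<Sum>i\<in>UNIV. Poly_Mapping.lookup m (Inl i)) = k1 + l1 \<and>
             (\<Sum>i\<in>UNIV. Poly_Mapping.lookup m (Inr i)) = k2 + l2"
    using assms by (auto simp: bihom_def lookup_add sum.distrib)
qed

lemma bihom_var_x: "var_x i \<in> bihom 1 0"
  by (simp add: bihom_def var_x_def lookup_single when_def)

lemma bihom_var_y: "var_y i \<in> bihom 0 1"
  by (simp add: bihom_def var_y_def lookup_single when_def)

lemma ideal_I_0: "0 \<in> ideal_I"
  unfolding ideal_I_def by (auto intro: exI[of _ 0])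

lemma ideal_I_add: "p \<in> ideal_I \<Longrightarrow> q \<in> ideal_I \<Longrightarrow> p + q \<in> ideal_I"
  unfolding ideal_I_def by (auto simp flip: distrib_right)

lemma ideal_I_uminus: "p \<in> ideal_I \<Longrightarrow> - p \<in> ideal_I"
  unfolding ideal_I_def by (auto simp flip: mult_minus_left)

lemma ideal_I_scaleR: "p \<in> ideal_I \<Longrightarrow> c *\<^sub>R p \<in> ideal_I"
  unfolding ideal_I_def by (auto simp: scaleR_poly_mult)

subsection \<open>Evaluation is a ring homomorphism\<close>

lemma monom_eval_add: "monom_eval (a + b) z = monom_eval a z * monom_eval b z"
  by (simp add: monom_eval_def lookup_add power_add prod.distrib)

lemma poly_eval_0 [simp]: "poly_eval 0 z = 0"
  by (simp add: poly_eval_def)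

lemma poly_eval_add: "poly_eval (p + q) z = poly_eval p z + poly_eval q z"
  unfolding poly_eval_def
  by (rule setsum_keys_plus_distrib[where f = "\<lambda>m c. c * monom_eval m z"])
     (simp_all add: distrib_right)

lemma poly_eval_single: "poly_eval (Poly_Mapping.single m c) z = c * monom_eval m z"
  by (simp add: poly_eval_def)

lemma poly_induct_single [case_names zero single]:
  fixes p :: "'a \<Rightarrow>\<^sub>0 real"
  assumes "P 0" "\<And>p m c. P p \<Longrightarrow> P (p + Poly_Mapping.single m c)"
  shows "P p"
proof (induction p rule: update_induct)
  case const
  show ?case by (rule assms(1))
next
  case (update f a b)
  have "Poly_Mapping.update a b f = f + Poly_Mapping.single a b"
    using update(1)
    by (intro poly_mapping_eqI)
       (auto simp: lookup_update lookup_add lookup_single when_def in_keys_iff)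
  then show ?case using assms(2)[OF update(3)] by simp
qed

lemma poly_eval_mult_single:
  "poly_eval (p * Poly_Mapping.single m c) z = poly_eval p z * (c * monom_eval m z)"
  by (induction p rule: poly_induct_single)
     (simp_all add: distrib_right poly_eval_add mult_single poly_eval_single monom_eval_add)

lemma poly_eval_mult: "poly_eval (p * q) z = poly_eval p z * poly_eval q z"
  by (induction q rule: poly_induct_single)
     (simp_all add: distrib_left poly_eval_add poly_eval_mult_single poly_eval_single)

lemma poly_eval_sum: "poly_eval (sum f A) z = (\<Sum>i\<in>A. poly_eval (f i) z)"
  by (induction A rule: infinite_finite_induct) (simp_all add: poly_eval_add)

lemma poly_eval_var_x: "poly_eval (var_x i) z = fst z $ i"
  by (simp add: var_x_def poly_eval_single monom_eval_def lookup_single when_def if_distrib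
      cong: if_cong)

lemma poly_eval_var_y: "poly_eval (var_y i) z = snd z $ i"
  by (simp add: var_y_def poly_eval_single monom_eval_def lookup_single when_def if_distrib
      cong: if_cong)

lemma poly_eval_ideal_I:
  assumes "p \<in> ideal_I" "z \<in> variety_I"
  shows "poly_eval p z = 0"
  using assms
  by (auto simp: ideal_I_def variety_I_def poly_eval_mult poly_eval_sum poly_eval_var_x
      poly_eval_var_y inner_vec_def mult.commute)

section \<open>The quotient space\<close>

text \<open>
  The type \<open>'n quot\<close> is the quotient of \<^term>\<open>bihom 2 2\<close> by its intersection with \<^term>\<open>ideal_I\<close>:
  the relation below is partial, so that all classes are classes of elements of \<^term>\<open>bihom 2 2\<close>.
\<close>

definition quot_rel :: "('n::finite) xypoly \<Rightarrow> 'n xypoly \<Rightarrow> bool" where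
  "quot_rel p q \<longleftrightarrow> p \<in> bihom 2 2 \<and> q \<in> bihom 2 2 \<and> p - q \<in> ideal_I"

lemma part_equivp_quot_rel: "part_equivp (quot_rel :: ('n::finite) xypoly \<Rightarrow> _)"
proof (rule part_equivpI)
  show "\<exists>p :: 'n xypoly. quot_rel p p"
    by (auto simp: quot_rel_def bihom_0 ideal_I_0 intro!: exI[of _ 0])
  show "symp (quot_rel :: 'n xypoly \<Rightarrow> _)"
    by (rule sympI) (metis quot_rel_def ideal_I_uminus minus_diff_eq)
  show "transp (quot_rel :: 'n xypoly \<Rightarrow> _)"
  proof (rule transpI)
    fix p q r :: "'n xypoly"
    assume "quot_rel p q" "quot_rel q r"
    then show "quot_rel p r"
      using ideal_I_add[of "p - q" "q - r"] by (simp add: quot_rel_def)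
  qed
qed

quotient_type (overloaded) 'n quot = "('n::finite) xypoly" / partial: quot_rel
  by (rule part_equivp_quot_rel)

instantiation quot :: (finite) real_vector
begin

lift_definition zero_quot :: "'a quot" is 0
  by (simp add: quot_rel_def bihom_0 ideal_I_0)

lift_definition plus_quot :: "'a quot \<Rightarrow> 'a quot \<Rightarrow> 'a quot" is "(+)"
proof -
  fix p p' q q' :: "'a xypoly"
  assume "quot_rel p p'" "quot_rel q q'"
  then show "quot_rel (p + q) (p' + q')"
    using ideal_I_add[of "p - p'" "q - q'"] by (simp add: quot_rel_def bihom_add add_diff_add)
qed

lift_definition minus_quot :: "'a quot \<Rightarrow> 'a quot \<Rightarrow> 'a quot" is "(-)"
proof -
  fix p p' q q' :: "'a xypoly"
  assume "quot_rel p p'" "quot_rel q q'"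
  moreover have "p - q - (p' - q') = (p - p') + - (q - q')" by simp
  moreover have "p - p' + - (q - q') \<in> ideal_I"
    using calculation(1,2) by (intro ideal_I_add ideal_I_uminus) (auto simp: quot_rel_def)
  ultimately have "p - q - (p' - q') \<in> ideal_I"
    by (simp only:)
  then show "quot_rel (p - q) (p' - q')"
    using \<open>quot_rel p p'\<close> \<open>quot_rel q q'\<close> by (simp add: quot_rel_def bihom_diff)
qed

lift_definition uminus_quot :: "'a quot \<Rightarrow> 'a quot" is uminus
proof -
  fix p p' :: "'a xypoly"
  assume "quot_rel p p'"
  then show "quot_rel (- p) (- p')"
    using ideal_I_uminus[of "p - p'"] by (simp add: quot_rel_def bihom_uminus)
qed

lift_definition scaleR_quot :: "real \<Rightarrow> 'a quot \<Rightarrow> 'a quot" is scaleR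
proof -
  fix c :: real and p p' :: "'a xypoly"
  assume "quot_rel p p'"
  then show "quot_rel (c *\<^sub>R p) (c *\<^sub>R p')"
    using ideal_I_scaleR[of "p - p'" c]
    by (simp add: quot_rel_def bihom_scaleR scaleR_diff_right)
qed

instance
proof
  fix a b c :: "'a quot" and r s :: real
  show "a + b + c = a + (b + c)"
    by transfer (simp add: quot_rel_def bihom_add ideal_I_0 add.assoc)
  show "a + b = b + a"
    by transfer (simp add: quot_rel_def bihom_add ideal_I_0 add.commute)
  show "0 + a = a"
    by transfer (simp add: quot_rel_def ideal_I_0)
  show "- a + a = 0"
    by transfer (simp add: quot_rel_def bihom_0 ideal_I_0)
  show "a - b = a + - b"
    by transfer (simp add: quot_rel_def bihom_diff ideal_I_0)
  show "r *\<^sub>R (a + b) = r *\<^sub>R a + r *\<^sub>R b"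
    by transfer (simp add: quot_rel_def bihom_add bihom_scaleR ideal_I_0 scaleR_add_right)
  show "(r + s) *\<^sub>R a = r *\<^sub>R a + s *\<^sub>R a"
    by transfer (simp add: quot_rel_def bihom_add bihom_scaleR ideal_I_0 scaleR_add_left)
  show "r *\<^sub>R s *\<^sub>R a = (r * s) *\<^sub>R a"
    by transfer (simp add: quot_rel_def bihom_scaleR ideal_I_0)
  show "1 *\<^sub>R a = a"
    by transfer (simp add: quot_rel_def ideal_I_0)
qed

end

text \<open>Elements of the quotient as functions on the variety (undefined outside of it).\<close>

lift_definition quot_eval :: "('n::finite) quot \<Rightarrow> (real^'n) \<times> (real^'n) \<Rightarrow> real"
  is "\<lambda>p. restrict (poly_eval p) variety_I"
proof (rule ext)
  fix p q :: "'n xypoly" and z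
  assume "quot_rel p q"
  then show "restrict (poly_eval p) variety_I z = restrict (poly_eval q) variety_I z"
    using poly_eval_ideal_I[of "p - q" z] poly_eval_add[of "p - q" q z]
    by (auto simp: quot_rel_def restrict_def)
qed

text \<open>The class of \<open>(\<Sum>\<^sub>i x\<^sub>i\<^sup>2) (\<Sum>\<^sub>i y\<^sub>i\<^sup>2)\<close>.\<close>

lift_definition norm_form :: "('n::finite) quot"
  is "(\<Sum>i\<in>UNIV. (var_x i)^2) * (\<Sum>i\<in>UNIV. (var_y i)^2)"
proof -
  have "(var_x i)^2 \<in> bihom 2 0" "(var_y i)^2 \<in> bihom 0 2" for i :: 'n
    using bihom_mult[OF bihom_var_x[of i] bihom_var_x[of i]]
      bihom_mult[OF bihom_var_y[of i] bihom_var_y[of i]]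
    by (simp_all add: power2_eq_square numeral_2_eq_2)
  then have "(\<Sum>i\<in>UNIV. (var_x i)^2) * (\<Sum>i\<in>(UNIV :: 'n set). (var_y i)^2) \<in> bihom (2 + 0) (0 + 2)"
    by (intro bihom_mult bihom_sum)
  then have "(\<Sum>i\<in>UNIV. (var_x i)^2) * (\<Sum>i\<in>(UNIV :: 'n set). (var_y i)^2) \<in> bihom 2 2"
    by (simp only: add_0_left add_0_right)
  then show ?thesis
    by (simp add: quot_rel_def ideal_I_0)
qed

text \<open>\<^const>\<open>abs_quot\<close> maps an element of \<^term>\<open>bihom 2 2\<close> to its class.\<close>

definition Sos :: "('n::finite) quot set" where
  "Sos = {abs_quot p |p. p \<in> bihom 2 2 \<and>
     (\<exists>(k::nat) q. (\<forall>i<k. q i \<in> bihom 1 1) \<and> p - (\<Sum>i<k. (q i)^2) \<in> ideal_I)}"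

section \<open>Integration over orthonormal pairs\<close>

definition orthonormal_pairs :: "((real^'n) \<times> (real^'n)) set" where
  "orthonormal_pairs = (sphere 0 1 \<times> sphere 0 1) \<inter> variety_I"

text \<open>
  Since the rotations act transitively on the orthonormal pairs for \<open>n \<ge> 3\<close>, exactly one measure
  satisfies the following predicate in that case.
\<close>

definition invariant_prob :: "((real^'n) \<times> (real^'n)) measure \<Rightarrow> bool" where
  "invariant_prob \<sigma> \<longleftrightarrow>
     sets \<sigma> = sets (restrict_space borel orthonormal_pairs) \<and>
     prob_space \<sigma> \<and>
     (\<forall>g :: real^'n^'n. rotation_matrix g \<longrightarrow> distr \<sigma> \<sigma> (\<lambda>(x, y). (g *v x, g *v y)) = \<sigma>)"

definition hyperplane_H :: "((real^'n) \<times> (real^'n)) measure \<Rightarrow> 'n quot set" where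
  "hyperplane_H \<sigma> = {f. (LINT z|\<sigma>. quot_eval f z) = 1}"

definition space_M :: "((real^'n) \<times> (real^'n)) measure \<Rightarrow> 'n quot set" where
  "space_M \<sigma> = {f. (LINT z|\<sigma>. quot_eval f z) = 0}"

definition inner_M :: "((real^'n) \<times> (real^'n)) measure \<Rightarrow> 'n quot \<Rightarrow> 'n quot \<Rightarrow> real" where
  "inner_M \<sigma> f g = (LINT z|\<sigma>. quot_eval f z * quot_eval g z)"

definition unit_ball_M :: "((real^'n) \<times> (real^'n)) measure \<Rightarrow> 'n quot set" where
  "unit_ball_M \<sigma> = {f \<in> space_M \<sigma>. inner_M \<sigma> f f \<le> 1}"

definition Sos_tilde :: "((real^'n) \<times> (real^'n)) measure \<Rightarrow> 'n quot set" where
  "Sos_tilde \<sigma> = {f. f + norm_form \<in> Sos \<inter> hyperplane_H \<sigma>}"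

definition dim_M :: "nat \<Rightarrow> nat" where
  "dim_M n = ((n + 1) choose 2)^2 - n^2 - 1"

definition linear_isometry_M ::
    "((real^'n) \<times> (real^'n)) measure \<Rightarrow> (real^'d \<Rightarrow> 'n quot) \<Rightarrow> bool" where
  "linear_isometry_M \<sigma> \<phi> \<longleftrightarrow>
     linear \<phi> \<and> range \<phi> = space_M \<sigma> \<and> (\<forall>u v. inner_M \<sigma> (\<phi> u) (\<phi> v) = u \<bullet> v)"

text \<open>
  The value at \<open>A\<close> of the pushforward of Lebesgue measure along \<open>\<phi>\<close>; it is meant for linear
  isometries \<open>\<phi>\<close>, for which it does not depend on \<open>\<phi>\<close>.
\<close>

definition Vol :: "(real^'d \<Rightarrow> 'n::finite quot) \<Rightarrow> 'n quot set \<Rightarrow> real" where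
  "Vol \<phi> A = measure lebesgue (\<phi> -` A)"

end

theory Submission
  imports Defs "HOL-Probability.Distributions"
begin

text \<open>
  An element of \<open>Sos_tilde \<sigma>\<close> is, on the set of orthonormal pairs, a sum of squares of bilinear forms with
  integral \<open>1\<close>, minus the constant \<open>1\<close>. There are only about \<open>n\<^sup>2\<close> independent bilinear forms, whereas the space of
  mean zero functions has dimension \<open>D\<close> of about \<open>n\<^sup>4 / 4\<close>; the volume is small because the elements are
  described by much less data than a ball in dimension \<open>D\<close> needs. The proof turns this into a bound without
  mean widths or covering numbers.

  Draw \<open>k = n\<^sup>2\<close> matrices with independent normal entries of variance \<open>\<tau>\<^sup>2\<close>, and let \<open>\<psi>\<close> be the projection to the
  mean zero functions of the sum of the squares of the corresponding bilinear forms. Let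
  \<open>f + 1 = \<Sum>\<^sub>i (a\<^sub>i \<bullet> tensor z)\<^sup>2\<close> represent a point of the set. If the random matrices are translated by
  the \<open>a\<^sub>i\<close>, then \<open>\<psi>\<close> has mean \<open>f\<close>, since the noise contributes a constant: the entries of \<open>tensor z\<close>, the
  products of the coordinates of \<open>x\<close> and \<open>y\<close>, have squares that add up to \<open>1\<close>. Its variance is at most
  \<open>\<rho>\<^sup>2 = 4 \<tau>\<^sup>2 + 2 k \<tau>\<^sup>4\<close> (lemma \<open>Sos_tilde_gaussian_approximation\<close>).
  Undoing the translation costs a factor \<open>exp (- \<Sum>\<^sub>i (norm a\<^sub>i)\<^sup>2 / (2 \<tau>\<^sup>2))\<close> by Jensen's inequality.
  Hence a Gaussian kernel around one and the same random point \<open>\<psi>\<close> has a substantial expected value at every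
  point of the set, and integrating over the set bounds its volume
  (lemma \<open>emeasure_le_of_gaussian_approximation\<close>).

  Two facts make the constants come out right. A sum of squares of linear forms on a space of dimension
  \<open>m\<close> is a sum of \<open>m\<close> such squares (lemma \<open>sum_of_squares_reduce\<close>), so \<open>n\<^sup>2\<close> matrices suffice.
  And \<open>(norm a)\<^sup>2\<close> is at most \<open>n\<^sup>2 + n - 2\<close> times the second moment of the bilinear form of \<open>a\<close>
  for a traceless matrix \<open>a\<close> (lemma \<open>traceless_norm_le\<close>), so \<open>\<Sum>\<^sub>i (norm a\<^sub>i)\<^sup>2\<close> is at most \<open>n\<^sup>2 + n - 2\<close>, which is
  about \<open>2 sqrt D\<close>. With \<open>\<tau>\<close> about \<open>2 / n\<close> the loss is a constant to the power \<open>D\<close>, and \<open>\<rho>\<close> is of order \<open>1 / n\<close>.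
\<close>

section \<open>Moments of the standard Gaussian measure\<close>

text \<open>
  The standard Gaussian measure. The product form of the density makes the coordinates visibly
  independent, and its logarithm is quadratic, so that a translation changes it by a linear term.
\<close>

definition gaussian :: "'a::euclidean_space measure" where
  "gaussian = density lborel (\<lambda>z. ennreal (\<Prod>b\<in>Basis. std_normal_density (z \<bullet> b)))"

lemma prod_normal_density_inner:
  fixes u w :: "'a::euclidean_space"
  assumes "s > 0"
  shows "(\<Prod>b\<in>Basis. normal_density (w \<bullet> b) s (u \<bullet> b)) =
    exp (- (norm (u - w))\<^sup>2 / (2 * s\<^sup>2)) / (sqrt (2 * pi) * s) ^ DIM('a)"
proof -
  have "(\<Sum>b\<in>Basis. - (u \<bullet> b - w \<bullet> b)\<^sup>2 / (2 * s\<^sup>2)) = - (norm (u - w))\<^sup>2 / (2 * s\<^sup>2)"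
    unfolding power2_norm_eq_inner euclidean_inner[of "u - w" "u - w"]
    by (simp add: inner_diff_left power2_eq_square sum_divide_distrib sum_negf)
  then show ?thesis
    using assms
    by (simp add: normal_density_def prod_dividef flip: exp_sum)
      (simp add: real_sqrt_mult power_mult_distrib)
qed

lemma nn_integral_exp_norm_diff:
  fixes w :: "'a::euclidean_space"
  assumes "s > 0"
  shows "(\<integral>\<^sup>+u. ennreal (exp (- (norm (u - w))\<^sup>2 / (2 * s\<^sup>2))) \<partial>lborel)
    = ennreal ((sqrt (2 * pi) * s) ^ DIM('a))"
proof -
  have "exp (- (norm (u - w))\<^sup>2 / (2 * s\<^sup>2)) =
      (sqrt (2 * pi) * s) ^ DIM('a) * (\<Prod>b\<in>Basis. normal_density (w \<bullet> b) s (u \<bullet> b))" for u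
    using assms by (simp add: prod_normal_density_inner)
  then have "(\<integral>\<^sup>+u. ennreal (exp (- (norm (u - w))\<^sup>2 / (2 * s\<^sup>2))) \<partial>lborel) =
    (\<integral>\<^sup>+u. ennreal ((sqrt (2 * pi) * s) ^ DIM('a)) *
        (\<Prod>b\<in>Basis. ennreal (normal_density (w \<bullet> b) s (u \<bullet> b))) \<partial>lborel)"
    using assms by (simp add: ennreal_mult prod_nonneg prod_ennreal)
  also have "\<dots> = ennreal ((sqrt (2 * pi) * s) ^ DIM('a))"
    using assms
    by (subst nn_integral_cmult; (subst nn_integral_lborel_prod)?)
      (simp_all add: nn_integral_eq_integral integral_normal_density integrable_normal_density)
  finally show ?thesis .
qed

lemma sets_gaussian [simp, measurable_cong]: "sets gaussian = sets borel"
  by (simp add: gaussian_def)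

lemma space_gaussian [simp]: "space gaussian = UNIV"
  by (simp add: gaussian_def)

lemma emeasure_gaussian_box:
  fixes B :: "'a::euclidean_space \<Rightarrow> real set"
  assumes [measurable]: "\<And>b. b \<in> Basis \<Longrightarrow> B b \<in> sets borel"
  shows "emeasure gaussian {z. \<forall>b\<in>Basis. z \<bullet> b \<in> B b} =
    (\<Prod>b\<in>Basis. emeasure (density lborel std_normal_density) (B b))"
proof -
  have [measurable]: "{z. \<forall>b\<in>Basis. z \<bullet> b \<in> B b} \<in> sets borel"
  proof -
    have "{z. \<forall>b\<in>Basis. z \<bullet> b \<in> B b} = (\<Inter>b\<in>Basis. (\<lambda>z. z \<bullet> b) -` B b \<inter> space borel)" by auto
    also have "\<dots> \<in> sets borel"
      by (intro sets.finite_INT measurable_sets[of _ borel borel]) auto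
    finally show ?thesis .
  qed
  have "emeasure gaussian {z. \<forall>b\<in>Basis. z \<bullet> b \<in> B b} =
      (\<integral>\<^sup>+z. (\<Prod>b\<in>Basis. ennreal (std_normal_density (z \<bullet> b)) * indicator (B b) (z \<bullet> b)) \<partial>lborel)"
    unfolding gaussian_def
    by (subst emeasure_density)
      (auto intro!: nn_integral_cong simp: prod.distrib prod_ennreal split: split_indicator)
  also have "\<dots> = (\<Prod>b\<in>Basis. emeasure (density lborel std_normal_density) (B b))"
    by (subst nn_integral_lborel_prod) (auto intro!: prod.cong simp: emeasure_density)
  finally show ?thesis .
qed

lemma emeasure_std_normal_UNIV: "emeasure (density lborel std_normal_density) UNIV = 1"
  using prob_space.emeasure_space_1[OF prob_space_normal_density[of 1 0]] by simp

lemma prob_space_gaussian: "prob_space (gaussian :: 'a::euclidean_space measure)"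
  using emeasure_gaussian_box[of "\<lambda>_::'a. UNIV"]
  by (intro prob_spaceI) (simp add: emeasure_std_normal_UNIV)

interpretation gaussian: prob_space "gaussian :: 'a::euclidean_space measure"
  by (rule prob_space_gaussian)

lemma distributed_gaussian_Basis:
  fixes b :: "'a::euclidean_space"
  assumes b: "b \<in> Basis"
  shows "distributed gaussian lborel (\<lambda>z. z \<bullet> b) std_normal_density"
  unfolding distributed_def
proof (intro conjI measure_eqI)
  fix A assume "A \<in> sets (distr gaussian lborel (\<lambda>z. z \<bullet> b))"
  then have A [measurable]: "A \<in> sets borel" by simp
  have "emeasure (distr gaussian lborel (\<lambda>z. z \<bullet> b)) A = emeasure gaussian {z. z \<bullet> b \<in> A}"
    by (simp add: emeasure_distr vimage_def)
  also have "{z. z \<bullet> b \<in> A} = {z. \<forall>c\<in>Basis. z \<bullet> c \<in> (if c = b then A else UNIV)}"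
    using b by auto
  also have "emeasure gaussian \<dots> = emeasure (density lborel std_normal_density) A"
    using b emeasure_gaussian_box[of "\<lambda>c::'a. if c = b then A else UNIV"]
    by (simp add: if_distrib emeasure_std_normal_UNIV prod.delta cong: if_cong)
  finally show "emeasure (distr gaussian lborel (\<lambda>z. z \<bullet> b)) A =
    emeasure (density lborel std_normal_density) A" .
qed auto

lemma indep_vars_gaussian_Basis:
  "gaussian.indep_vars (\<lambda>_. borel) (\<lambda>b z. z \<bullet> b) (Basis :: 'a::euclidean_space set)"
  unfolding gaussian.indep_vars_def2
proof (intro conjI ballI)
  show "gaussian.indep_sets (\<lambda>b. {(\<lambda>z. z \<bullet> b) -` A \<inter> space gaussian |A. A \<in> sets borel})
     (Basis :: 'a set)"
    unfolding gaussian.indep_sets_def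
  proof (intro conjI ballI allI impI)
    fix b :: 'a
    show "{(\<lambda>z. z \<bullet> b) -` A \<inter> space gaussian |A. A \<in> sets borel} \<subseteq> gaussian.events"
      by (auto intro!: measurable_sets_borel[of _ borel])
  next
    fix J :: "'a set" and A
    assume J: "J \<subseteq> Basis" "J \<noteq> {}" "finite J"
      and A: "A \<in> (\<Pi> j\<in>J. {(\<lambda>z. z \<bullet> j) -` A \<inter> space gaussian |A. A \<in> sets borel})"
    from A have "\<forall>j\<in>J. \<exists>C. C \<in> sets borel \<and> A j = (\<lambda>z. z \<bullet> j) -` C" by (auto simp: Pi_iff)
    then obtain C where C: "\<And>j. j \<in> J \<Longrightarrow> C j \<in> sets borel" "\<And>j. j \<in> J \<Longrightarrow> A j = (\<lambda>z. z \<bullet> j) -` C j"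
      by metis
    have prob: "emeasure gaussian (A j) = emeasure (density lborel std_normal_density) (C j)"
      if "j \<in> J" for j
    proof -
      have "emeasure gaussian (A j) = emeasure (distr gaussian lborel (\<lambda>z. z \<bullet> j)) (C j)"
        using C that by (subst emeasure_distr) auto
      then show ?thesis
        using distributed_gaussian_Basis[of j] that J by (auto simp: distributed_def)
    qed
    have "(\<Inter>j\<in>J. A j) = {z. \<forall>b\<in>Basis. z \<bullet> b \<in> (if b \<in> J then C b else UNIV)}"
      using C J by auto
    then have "emeasure gaussian (\<Inter>j\<in>J. A j) = (\<Prod>b\<in>Basis.
        emeasure (density lborel std_normal_density) (if b \<in> J then C b else UNIV))"
      using C by (simp only:, subst emeasure_gaussian_box) auto
    also have "\<dots> = (\<Prod>b\<in>Basis. if b \<in> J then emeasure gaussian (A b) else 1)"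
      by (rule prod.cong) (auto simp: emeasure_std_normal_UNIV prob)
    also have "\<dots> = (\<Prod>j\<in>J. emeasure gaussian (A j))"
      using J by (simp add: prod.If_cases Int_absorb1)
    finally show "gaussian.prob (\<Inter>j\<in>J. A j) = (\<Prod>j\<in>J. gaussian.prob (A j))"
      by (simp add: gaussian.emeasure_eq_measure prod_ennreal prod_nonneg)
  qed
qed auto

text \<open>
  A linear functional is a sum of independent centred normal variables, one for each basis vector on
  which it does not vanish; all moments of polynomials below are read off from its law by polarization.
\<close>

lemma distributed_gaussian_inner:
  fixes a :: "'a::euclidean_space"
  assumes "a \<noteq> 0"
  shows "distributed gaussian lborel (\<lambda>z. z \<bullet> a) (normal_density 0 (norm a))"
proof -
  define J where "J = {b\<in>Basis. a \<bullet> b \<noteq> 0}"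
  have J: "finite J" "J \<noteq> {}" "J \<subseteq> Basis"
    using assms euclidean_all_zero_iff[of a] by (auto simp: J_def)
  have "gaussian.indep_vars (\<lambda>_. borel) (\<lambda>b z. (a \<bullet> b) * (z \<bullet> b)) J"
    using gaussian.indep_vars_compose2[OF gaussian.indep_vars_subset[OF indep_vars_gaussian_Basis J(3)],
        where Y="\<lambda>b x. (a \<bullet> b) * x" and N="\<lambda>_. borel"] by simp
  moreover have "distributed gaussian lborel (\<lambda>z. (a \<bullet> b) * (z \<bullet> b)) (normal_density 0 \<bar>a \<bullet> b\<bar>)"
    if "b \<in> J" for b
    using gaussian.normal_density_affine[OF distributed_gaussian_Basis[of b], of "a \<bullet> b" 0] that
    by (auto simp: J_def)
  ultimately have "distributed gaussian lborel (\<lambda>z. \<Sum>b\<in>J. (a \<bullet> b) * (z \<bullet> b))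
      (normal_density (\<Sum>b\<in>J. 0) (sqrt (\<Sum>b\<in>J. \<bar>a \<bullet> b\<bar>\<^sup>2)))"
    using J by (intro gaussian.sum_indep_normal) (auto simp: J_def)
  moreover have "(\<Sum>b\<in>J. (a \<bullet> b) * (z \<bullet> b)) = z \<bullet> a" for z
    unfolding euclidean_inner[of z a] J_def by (rule sum.mono_neutral_cong_left) auto
  moreover have "(\<Sum>b\<in>J. \<bar>a \<bullet> b\<bar>\<^sup>2) = (norm a)\<^sup>2"
    unfolding power2_norm_eq_inner euclidean_inner[of a a] J_def
    by (rule sum.mono_neutral_cong_left) (auto simp: power2_eq_square)
  ultimately show ?thesis by simp
qed


lemma has_bochner_integral_gaussian_inner:
  fixes a :: "'a::euclidean_space" and f :: "real \<Rightarrow> real"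
  assumes "a \<noteq> 0" and [measurable]: "f \<in> borel_measurable borel"
    and "has_bochner_integral lborel (\<lambda>x. normal_density 0 (norm a) x * f x) v"
  shows "has_bochner_integral gaussian (\<lambda>z. f (z \<bullet> a)) v"
proof -
  have *: "distr gaussian lborel (\<lambda>z. z \<bullet> a) = density lborel (normal_density 0 (norm a))"
    using distributed_gaussian_inner[OF assms(1)] by (simp add: distributed_def)
  have "has_bochner_integral (density lborel (normal_density 0 (norm a))) f v"
    using assms by (intro has_bochner_integral_density) auto
  then have "has_bochner_integral (distr gaussian lborel (\<lambda>z. z \<bullet> a)) f v"
    by (simp only: *)
  then show ?thesis
    by (simp add: has_bochner_integral_iff integrable_distr_eq integral_distr)
qed

lemma gaussian_inner_moment_2:
  fixes a :: "'a::euclidean_space"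
  shows "has_bochner_integral gaussian (\<lambda>z. (z \<bullet> a)\<^sup>2) ((norm a)\<^sup>2)"
proof (cases "a = 0")
  case False
  have "has_bochner_integral lborel (\<lambda>x. normal_density 0 (norm a) x * x\<^sup>2) ((norm a)\<^sup>2)"
    using normal_moment_even[of "norm a" 0 1] False by (simp add: fact_numeral)
  then show ?thesis
    by (intro has_bochner_integral_gaussian_inner False) auto
qed (simp add: has_bochner_integral_zero)

lemma gaussian_inner_moment_4:
  fixes a :: "'a::euclidean_space"
  shows "has_bochner_integral gaussian (\<lambda>z. (z \<bullet> a) ^ 4) (3 * norm a ^ 4)"
proof (cases "a = 0")
  case False
  have "has_bochner_integral lborel (\<lambda>x. normal_density 0 (norm a) x * x ^ 4) (3 * norm a ^ 4)"
    using normal_moment_even[of "norm a" 0 2] False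
    by (simp add: fact_numeral power_divide flip: power_mult)
  then show ?thesis
    by (intro has_bochner_integral_gaussian_inner False) auto
qed (simp add: has_bochner_integral_zero)

lemma gaussian_inner_moment_odd:
  fixes a :: "'a::euclidean_space"
  shows "has_bochner_integral gaussian (\<lambda>z. (z \<bullet> a) ^ (2 * k + 1)) 0"
proof (cases "a = 0")
  case False
  then show ?thesis
    using normal_moment_odd[of "norm a" 0 k] by (intro has_bochner_integral_gaussian_inner) auto
qed (simp add: has_bochner_integral_zero)

lemma gaussian_inner_moment_1:
  "has_bochner_integral gaussian (\<lambda>z. z \<bullet> (a :: 'a::euclidean_space)) 0"
  using gaussian_inner_moment_odd[of a 0] by simp

lemma gaussian_inner_moment_11:
  fixes a b :: "'a::euclidean_space"
  shows "has_bochner_integral gaussian (\<lambda>z. (z \<bullet> a) * (z \<bullet> b)) (a \<bullet> b)"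
proof -
  have "has_bochner_integral gaussian
      (\<lambda>z. ((z \<bullet> (a + b))\<^sup>2 - (z \<bullet> a)\<^sup>2 - (z \<bullet> b)\<^sup>2) / 2) (((norm (a + b))\<^sup>2 - (norm a)\<^sup>2 - (norm b)\<^sup>2) / 2)"
    by (intro has_bochner_integral_divide_zero has_bochner_integral_diff gaussian_inner_moment_2)
  moreover have "((norm (a + b))\<^sup>2 - (norm a)\<^sup>2 - (norm b)\<^sup>2) / 2 = a \<bullet> b"
    by (simp add: dot_norm)
  moreover have "((z \<bullet> (a + b))\<^sup>2 - (z \<bullet> a)\<^sup>2 - (z \<bullet> b)\<^sup>2) / 2 = (z \<bullet> a) * (z \<bullet> b)" for z
    by (simp add: inner_add_right power2_eq_square algebra_simps)
  ultimately show ?thesis by simp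
qed

lemma gaussian_inner_moment_21:
  fixes a b :: "'a::euclidean_space"
  shows "has_bochner_integral gaussian (\<lambda>z. (z \<bullet> a)\<^sup>2 * (z \<bullet> b)) 0"
proof -
  have "has_bochner_integral gaussian
      (\<lambda>z. ((z \<bullet> (a + b)) ^ (2 * 1 + 1) - (z \<bullet> (a - b)) ^ (2 * 1 + 1) - 2 * (z \<bullet> b) ^ (2 * 1 + 1)) / 6)
      ((0 - 0 - 2 * 0) / 6)"
    by (intro has_bochner_integral_divide_zero has_bochner_integral_diff has_bochner_integral_mult_right
        gaussian_inner_moment_odd)
  moreover have "((z \<bullet> (a + b)) ^ (2 * 1 + 1) - (z \<bullet> (a - b)) ^ (2 * 1 + 1) - 2 * (z \<bullet> b) ^ (2 * 1 + 1)) / 6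
      = (z \<bullet> a)\<^sup>2 * (z \<bullet> b)" for z
    by (simp add: inner_add_right inner_diff_right power2_eq_square algebra_simps)
  ultimately show ?thesis by simp
qed

text \<open>
  Isserlis' formula for two vectors, from the fourth moments of \<open>a + b\<close> and \<open>a - b\<close>.
\<close>

lemma gaussian_inner_moment_22:
  fixes a b :: "'a::euclidean_space"
  shows "has_bochner_integral gaussian (\<lambda>z. (z \<bullet> a)\<^sup>2 * (z \<bullet> b)\<^sup>2)
    ((norm a)\<^sup>2 * (norm b)\<^sup>2 + 2 * (a \<bullet> b)\<^sup>2)"
proof -
  have "has_bochner_integral gaussian
      (\<lambda>z. ((z \<bullet> (a + b)) ^ 4 + (z \<bullet> (a - b)) ^ 4 - 2 * (z \<bullet> a) ^ 4 - 2 * (z \<bullet> b) ^ 4) / 12)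
      ((3 * norm (a + b) ^ 4 + 3 * norm (a - b) ^ 4 - 2 * (3 * norm a ^ 4) - 2 * (3 * norm b ^ 4)) / 12)"
    by (intro has_bochner_integral_divide_zero has_bochner_integral_diff has_bochner_integral_add
        has_bochner_integral_mult_right gaussian_inner_moment_4)
  moreover have "((z \<bullet> (a + b)) ^ 4 + (z \<bullet> (a - b)) ^ 4 - 2 * (z \<bullet> a) ^ 4 - 2 * (z \<bullet> b) ^ 4) / 12
      = (z \<bullet> a)\<^sup>2 * (z \<bullet> b)\<^sup>2" for z
    by (simp add: inner_add_right inner_diff_right power4_eq_xxxx power2_eq_square algebra_simps)
  moreover have "(3 * norm (a + b) ^ 4 + 3 * norm (a - b) ^ 4 - 2 * (3 * norm a ^ 4) - 2 * (3 * norm b ^ 4)) / 12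
      = (norm a)\<^sup>2 * (norm b)\<^sup>2 + 2 * (a \<bullet> b)\<^sup>2"
  proof -
    have sq: "norm v ^ 4 = (v \<bullet> v)\<^sup>2" for v :: 'a
      unfolding power2_norm_eq_inner[symmetric] by simp
    show ?thesis
      unfolding sq power2_norm_eq_inner
      by (simp add: inner_add_left inner_add_right inner_diff_left inner_diff_right
          power2_eq_square inner_commute algebra_simps)
  qed
  ultimately show ?thesis by (simp only:)
qed

text \<open>
  The first and the second Hermite polynomials of independent standard normal variables are
  orthogonal, with squared norms \<open>1\<close> and \<open>2\<close>. For \<open>\<alpha>\<^sub>i = 2 \<tau> a\<^sub>i\<close> and \<open>\<beta> = \<tau>\<^sup>2\<close> the summand is
  \<open>(a\<^sub>i + \<tau> G\<^sub>i)\<^sup>2\<close> minus its expectation \<open>a\<^sub>i\<^sup>2 + \<tau>\<^sup>2\<close>, so the formula is the variance of a sum of squares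
  to which Gaussian noise was added.
\<close>

lemma gaussian_chaos_second_moment:
  fixes v :: "'i \<Rightarrow> 'a::euclidean_space" and \<alpha> :: "'i \<Rightarrow> real"
  assumes "finite I" and v: "\<And>i j. i \<in> I \<Longrightarrow> j \<in> I \<Longrightarrow> v i \<bullet> v j = (if i = j then 1 else 0)"
  shows "has_bochner_integral gaussian
    (\<lambda>z. (\<Sum>i\<in>I. \<alpha> i * (z \<bullet> v i) + \<beta> * ((z \<bullet> v i)\<^sup>2 - 1))\<^sup>2)
    ((\<Sum>i\<in>I. (\<alpha> i)\<^sup>2) + 2 * \<beta>\<^sup>2 * card I)"
proof -
  let ?G = "\<lambda>i z. z \<bullet> v i"
  let ?X = "\<lambda>i z. \<alpha> i * ?G i z + \<beta> * ((?G i z)\<^sup>2 - 1)"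
  have XX: "has_bochner_integral gaussian (\<lambda>z. ?X i z * ?X j z) (if i = j then (\<alpha> i)\<^sup>2 + 2 * \<beta>\<^sup>2 else 0)"
    if "i \<in> I" "j \<in> I" for i j
  proof -
    have n: "norm (v i) = 1" "norm (v j) = 1"
      using v that by (auto simp: norm_eq_sqrt_inner)
    have one: "has_bochner_integral gaussian (\<lambda>_ :: 'a. 1 :: real) 1"
      by (simp add: has_bochner_integral_iff gaussian.prob_space[unfolded space_gaussian])
    have "has_bochner_integral gaussian
       (\<lambda>z. \<alpha> i * \<alpha> j * (?G i z * ?G j z)
         + (\<alpha> i * \<beta> * ((?G j z)\<^sup>2 * ?G i z - ?G i z) + \<beta> * \<alpha> j * ((?G i z)\<^sup>2 * ?G j z - ?G j z)
         + \<beta>\<^sup>2 * ((?G i z)\<^sup>2 * (?G j z)\<^sup>2 - (?G i z)\<^sup>2 - (?G j z)\<^sup>2 + 1)))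
       (\<alpha> i * \<alpha> j * (v i \<bullet> v j) + (\<alpha> i * \<beta> * (0 - 0) + \<beta> * \<alpha> j * (0 - 0)
         + \<beta>\<^sup>2 * (((norm (v i))\<^sup>2 * (norm (v j))\<^sup>2 + 2 * (v i \<bullet> v j)\<^sup>2) - (norm (v i))\<^sup>2 - (norm (v j))\<^sup>2 + 1)))"
      by (intro has_bochner_integral_add has_bochner_integral_diff has_bochner_integral_mult_right
          gaussian_inner_moment_1 gaussian_inner_moment_2 gaussian_inner_moment_11
          gaussian_inner_moment_21 gaussian_inner_moment_22 one)
    moreover have "\<alpha> i * \<alpha> j * (?G i z * ?G j z)
         + (\<alpha> i * \<beta> * ((?G j z)\<^sup>2 * ?G i z - ?G i z) + \<beta> * \<alpha> j * ((?G i z)\<^sup>2 * ?G j z - ?G j z)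
         + \<beta>\<^sup>2 * ((?G i z)\<^sup>2 * (?G j z)\<^sup>2 - (?G i z)\<^sup>2 - (?G j z)\<^sup>2 + 1)) = ?X i z * ?X j z" for z
      by (simp add: power2_eq_square algebra_simps)
    moreover have "\<alpha> i * \<alpha> j * (v i \<bullet> v j) + (\<alpha> i * \<beta> * (0 - 0) + \<beta> * \<alpha> j * (0 - 0)
         + \<beta>\<^sup>2 * (((norm (v i))\<^sup>2 * (norm (v j))\<^sup>2 + 2 * (v i \<bullet> v j)\<^sup>2) - (norm (v i))\<^sup>2 - (norm (v j))\<^sup>2 + 1))
      = (if i = j then (\<alpha> i)\<^sup>2 + 2 * \<beta>\<^sup>2 else 0)"
      using v[OF that] by (simp add: n power2_eq_square)
    ultimately show ?thesis by simp
  qed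
  have "has_bochner_integral gaussian (\<lambda>z. \<Sum>i\<in>I. \<Sum>j\<in>I. ?X i z * ?X j z)
      (\<Sum>i\<in>I. \<Sum>j\<in>I. if i = j then (\<alpha> i)\<^sup>2 + 2 * \<beta>\<^sup>2 else 0)"
    by (intro has_bochner_integral_sum XX)
  moreover have "(\<Sum>i\<in>I. \<Sum>j\<in>I. if i = j then (\<alpha> i)\<^sup>2 + 2 * \<beta>\<^sup>2 else 0) =
      (\<Sum>i\<in>I. (\<alpha> i)\<^sup>2) + 2 * \<beta>\<^sup>2 * card I"
    using assms(1) by (simp add: sum.delta' sum.distrib)
  ultimately show ?thesis
    by (simp add: power2_eq_square[of "sum _ _"] sum_product)
qed

section \<open>Volume bounds from random approximation\<close>

lemma nn_integral_gaussian_shift: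
  fixes f :: "'a::euclidean_space \<Rightarrow> ennreal"
  assumes [measurable]: "f \<in> borel_measurable borel"
  shows "(\<integral>\<^sup>+z. f z \<partial>gaussian) =
    (\<integral>\<^sup>+z. ennreal (exp (- (z \<bullet> q) - (norm q)\<^sup>2 / 2)) * f (q + z) \<partial>gaussian)"
proof -
  let ?p = "\<lambda>z::'a. \<Prod>b\<in>Basis. std_normal_density (z \<bullet> b)"
  have p: "?p z = exp (- (norm z)\<^sup>2 / 2) / sqrt (2 * pi) ^ DIM('a)" for z
    using prod_normal_density_inner[of 1 0 z] by simp
  have shift: "?p (q + z) = ?p z * exp (- (z \<bullet> q) - (norm q)\<^sup>2 / 2)" for z
    unfolding p power2_norm_eq_inner
    by (simp add: inner_add_left inner_add_right inner_commute add_divide_distrib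
        flip: exp_add)
  have "(\<integral>\<^sup>+z. f z \<partial>gaussian) = (\<integral>\<^sup>+z. ennreal (?p z) * f z \<partial>distr lborel borel ((+) q))"
    unfolding lborel_distr_plus by (simp add: gaussian_def nn_integral_density)
  also have "\<dots> = (\<integral>\<^sup>+z. ennreal (?p z) * (ennreal (exp (- (z \<bullet> q) - (norm q)\<^sup>2 / 2)) * f (q + z)) \<partial>lborel)"
    by (subst nn_integral_distr)
      (simp_all add: shift ennreal_mult prod_nonneg mult.assoc)
  also have "\<dots> = (\<integral>\<^sup>+z. ennreal (exp (- (z \<bullet> q) - (norm q)\<^sup>2 / 2)) * f (q + z) \<partial>gaussian)"
    by (simp add: gaussian_def nn_integral_density)
  finally show ?thesis .
qed

text \<open>
  Translating the Gaussian by \<open>q\<close> and applying Jensen's inequality to the exponential: the linear part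
  of the density quotient has mean zero, so only its constant \<open>(norm q)\<^sup>2 / 2\<close>, the relative entropy of
  the translated Gaussian, is lost. (This is the variational principle of Gibbs.)
\<close>

lemma gaussian_exp_lower_bound:
  fixes W :: "'a::euclidean_space \<Rightarrow> real"
  assumes [measurable]: "W \<in> borel_measurable borel" and W: "\<And>z. W z \<ge> 0"
    and bound: "(\<integral>\<^sup>+z. ennreal (W (q + z)) \<partial>gaussian) \<le> ennreal r" and r: "r \<ge> 0"
  shows "ennreal (exp (- r - (norm q)\<^sup>2 / 2)) \<le> (\<integral>\<^sup>+z. ennreal (exp (- W z)) \<partial>gaussian)"
proof -
  define X where "X = (\<lambda>z. - W (q + z) - z \<bullet> q - (norm q)\<^sup>2 / 2)"
  define m where "m = - (\<integral>z. W (q + z) \<partial>gaussian) - (norm q)\<^sup>2 / 2"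
  have [measurable]: "X \<in> borel_measurable borel" unfolding X_def by measurable
  have intW: "integrable gaussian (\<lambda>z. W (q + z))"
    using bound W by (intro integrableI_nonneg) (auto simp: le_less_trans)
  have "ennreal (\<integral>z. W (q + z) \<partial>gaussian) \<le> ennreal r"
    using bound W by (subst nn_integral_eq_integral[symmetric]) (auto simp: intW)
  then have mr: "- r - (norm q)\<^sup>2 / 2 \<le> m"
    using r by (simp add: m_def ennreal_le_iff)
  have X: "has_bochner_integral gaussian X m"
  proof -
    have "has_bochner_integral gaussian X ((- (\<integral>z. W (q + z) \<partial>gaussian) - 0) - (norm q)\<^sup>2 / 2)"
      unfolding X_def
      by (intro has_bochner_integral_diff has_bochner_integral_minus gaussian_inner_moment_1
          has_bochner_integral_integrable intW)
        (simp add: has_bochner_integral_iff gaussian.prob_space[unfolded space_gaussian])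
    then show ?thesis by (simp add: m_def)
  qed
  have "ennreal (exp m) \<le> (\<integral>\<^sup>+z. ennreal (exp (X z)) \<partial>gaussian)"
  proof (cases "(\<integral>\<^sup>+z. ennreal (exp (X z)) \<partial>gaussian) = \<infinity>")
    case False
    then have int: "integrable gaussian (\<lambda>z. exp (X z))"
      by (intro integrableI_nonneg) (auto simp: top.not_eq_extremum)
    \<comment> \<open>Jensen's inequality in the form of the tangent to the exponential at the mean \<open>m\<close>.\<close>
    have tangent: "has_bochner_integral gaussian (\<lambda>z. exp m * (1 + (X z - m))) (exp m * (1 + (m - m)))"
      by (intro has_bochner_integral_mult_right has_bochner_integral_add has_bochner_integral_diff X)
        (simp_all add: has_bochner_integral_iff gaussian.prob_space[unfolded space_gaussian])
    have "exp m \<le> (\<integral>z. exp (X z) \<partial>gaussian)"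
    proof -
      have "(\<integral>z. exp m * (1 + (X z - m)) \<partial>gaussian) \<le> (\<integral>z. exp (X z) \<partial>gaussian)"
      proof (rule integral_mono)
        fix z
        have "exp m * (1 + (X z - m)) \<le> exp m * exp (X z - m)"
          by (intro mult_left_mono exp_ge_add_one_self) auto
        then show "exp m * (1 + (X z - m)) \<le> exp (X z)" by (simp flip: exp_add)
      qed (use tangent int in \<open>auto simp: has_bochner_integral_iff\<close>)
      with tangent show ?thesis by (simp add: has_bochner_integral_iff)
    qed
    then show ?thesis
      by (subst nn_integral_eq_integral) (auto simp: int)
  qed simp
  also have "\<dots> = (\<integral>\<^sup>+z. ennreal (exp (- (z \<bullet> q) - (norm q)\<^sup>2 / 2)) * ennreal (exp (- W (q + z))) \<partial>gaussian)"
    unfolding X_def by (intro nn_integral_cong) (simp add: diff_diff_eq2 algebra_simps flip: ennreal_mult exp_add)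
  also have "\<dots> = (\<integral>\<^sup>+z. ennreal (exp (- W z)) \<partial>gaussian)"
    by (rule nn_integral_gaussian_shift[symmetric]) measurable
  finally show ?thesis
    using mr by (auto intro: order_trans[rotated] simp: ennreal_le_iff)
qed

text \<open>
  At every point of \<open>S\<close>, a Gaussian kernel of variance \<open>s\<^sup>2\<close> around the random point \<open>\<psi> z\<close> has an expected
  value of at least \<open>exp (- DIM('b))\<close>, because translating \<open>z\<close> by a short vector \<open>q\<close> is cheap and
  \<open>\<psi> (q + z)\<close> is close to the point on average. The integral of a kernel over the whole space is known, so
  integrating over \<open>S\<close> and exchanging the integrals bounds the measure of \<open>S\<close>.
\<close>

lemma emeasure_le_of_gaussian_approximation:
  fixes S :: "'b::euclidean_space set" and \<psi> :: "'a::euclidean_space \<Rightarrow> 'b"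
  assumes S: "S \<in> sets lebesgue" and [measurable]: "\<psi> \<in> borel_measurable borel"
    and \<rho>: "\<rho> > 0"
    and approx: "\<And>u. u \<in> S \<Longrightarrow> \<exists>q. (norm q)\<^sup>2 \<le> DIM('b) \<and>
      (\<integral>\<^sup>+z. ennreal ((norm (u - \<psi> (q + z)))\<^sup>2) \<partial>gaussian) \<le> ennreal (\<rho>\<^sup>2)"
  shows "emeasure lebesgue S \<le> ennreal ((sqrt (2 * pi / DIM('b)) * exp 1 * \<rho>) ^ DIM('b))"
proof -
  define D where "D = real (DIM('b))"
  have D: "D > 0" by (simp add: D_def)
  \<comment> \<open>This \<open>s\<close> makes the loss \<open>\<rho>\<^sup>2 / (2 * s\<^sup>2)\<close> for the distance equal to \<open>D / 2\<close>, the bound on the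
      loss \<open>(norm q)\<^sup>2 / 2\<close> for the translation.\<close>
  define s where "s = \<rho> / sqrt D"
  have s: "s > 0" using \<rho> D by (simp add: s_def)
  have s2: "2 * s\<^sup>2 = 2 * \<rho>\<^sup>2 / D" using D by (simp add: s_def power_divide)
  define F where "F u = (\<integral>\<^sup>+z. ennreal (exp (- (norm (u - \<psi> z))\<^sup>2 / (2 * s\<^sup>2))) \<partial>gaussian)" for u
  have [measurable]: "(\<lambda>(u, z). ennreal (exp (- (norm (u - \<psi> z))\<^sup>2 / (2 * s\<^sup>2)))) \<in>
      borel_measurable (lborel \<Otimes>\<^sub>M gaussian)"
    by measurable
  have "sigma_finite_measure (gaussian :: 'a measure)" by unfold_locales
  then interpret pair: pair_sigma_finite "lborel :: 'b measure" "gaussian :: 'a measure"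
    by (intro pair_sigma_finite.intro) (auto intro: sigma_finite_lborel)
  have F: "F \<in> borel_measurable lborel"
    unfolding F_def by measurable
  have lower: "ennreal (exp (- D)) \<le> F u" if u: "u \<in> S" for u
  proof -
    obtain q where q: "(norm q)\<^sup>2 \<le> D"
      "(\<integral>\<^sup>+z. ennreal ((norm (u - \<psi> (q + z)))\<^sup>2) \<partial>gaussian) \<le> ennreal (\<rho>\<^sup>2)"
      using approx[OF u] by (auto simp: D_def)
    let ?W = "\<lambda>z. (norm (u - \<psi> z))\<^sup>2 / (2 * s\<^sup>2)"
    have "(\<integral>\<^sup>+z. ennreal (?W (q + z)) \<partial>gaussian) =
        ennreal (1 / (2 * s\<^sup>2)) * (\<integral>\<^sup>+z. ennreal ((norm (u - \<psi> (q + z)))\<^sup>2) \<partial>gaussian)"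
      by (subst nn_integral_cmult[symmetric]) (auto simp flip: ennreal_mult)
    also have "\<dots> \<le> ennreal (1 / (2 * s\<^sup>2)) * ennreal (\<rho>\<^sup>2)"
      by (intro mult_left_mono q) simp
    also have "\<dots> = ennreal (D / 2)"
      using \<rho> D by (simp add: s2 flip: ennreal_mult)
    finally have "ennreal (exp (- (D / 2) - (norm q)\<^sup>2 / 2)) \<le> (\<integral>\<^sup>+z. ennreal (exp (- ?W z)) \<partial>gaussian)"
      using D by (intro gaussian_exp_lower_bound) auto
    moreover have "ennreal (exp (- D)) \<le> ennreal (exp (- (D / 2) - (norm q)\<^sup>2 / 2))"
      using q(1) by (intro ennreal_leI) simp
    ultimately show ?thesis
      unfolding F_def minus_divide_left[symmetric] by (rule order_trans[rotated])
  qed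
  have "ennreal (exp (- D)) * emeasure lebesgue S = (\<integral>\<^sup>+u. ennreal (exp (- D)) * indicator S u \<partial>lebesgue)"
    using S by (simp add: nn_integral_cmult_indicator)
  also have "\<dots> \<le> (\<integral>\<^sup>+u. F u \<partial>lebesgue)"
    by (intro nn_integral_mono) (auto simp: lower split: split_indicator)
  also have "\<dots> = (\<integral>\<^sup>+u. F u \<partial>lborel)"
    by (rule nn_integral_completion)
  also have "\<dots> = (\<integral>\<^sup>+z. (\<integral>\<^sup>+u. ennreal (exp (- (norm (u - \<psi> z))\<^sup>2 / (2 * s\<^sup>2))) \<partial>lborel) \<partial>gaussian)"
    unfolding F_def by (rule pair.Fubini'[symmetric]) measurable
  also have "\<dots> = ennreal ((sqrt (2 * pi) * s) ^ DIM('b))"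
    by (simp only: nn_integral_exp_norm_diff[OF s])
      (simp add: gaussian.emeasure_space_1[unfolded space_gaussian])
  finally have "ennreal (exp D) * (ennreal (exp (- D)) * emeasure lebesgue S)
      \<le> ennreal (exp D) * ennreal ((sqrt (2 * pi) * s) ^ DIM('b))"
    by (intro mult_left_mono) auto
  also have "ennreal (exp D) * (ennreal (exp (- D)) * emeasure lebesgue S) = emeasure lebesgue S"
    by (simp add: mult.assoc[symmetric] flip: ennreal_mult exp_add)
  also have "ennreal (exp D) * ennreal ((sqrt (2 * pi) * s) ^ DIM('b)) =
      ennreal ((sqrt (2 * pi / DIM('b)) * exp 1 * \<rho>) ^ DIM('b))"
    using \<rho> by (simp add: s_def D_def real_sqrt_divide power_mult_distrib power_divide
        exp_of_nat_mult[of _ 1, simplified] mult_ac flip: ennreal_mult)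
  finally show ?thesis .
qed

section \<open>Reducing the number of squares\<close>

lemma dependent_family:
  fixes A :: "nat \<Rightarrow> 'a::euclidean_space"
  assumes "k \<ge> DIM('a)"
  obtains c where "(\<Sum>i\<le>k. c i *\<^sub>R A i) = 0" "(\<Sum>i\<le>k. (c i)\<^sup>2) = 1" "c k \<ge> 0"
proof -
  have "\<exists>d. (\<Sum>i\<le>k. d i *\<^sub>R A i) = 0 \<and> (\<exists>i\<le>k. d i \<noteq> 0)"
  proof (cases "inj_on A {..k}")
    case True
    then have "dependent (A ` {..k})"
      using assms by (intro dependent_biggerset) (auto simp: card_image)
    then obtain u where u: "(\<Sum>v\<in>A ` {..k}. u v *\<^sub>R v) = 0" "\<exists>v\<in>A ` {..k}. u v \<noteq> 0"
      by (subst (asm) dependent_finite) auto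
    then show ?thesis
      using True by (intro exI[of _ "u \<circ> A"]) (auto simp: sum.reindex)
  next
    case False
    then obtain i j where ij: "i \<le> k" "j \<le> k" "i \<noteq> j" "A i = A j" by (auto simp: inj_on_def)
    have "(\<Sum>l\<le>k. (if l = i then 1 else if l = j then - 1 else 0) *\<^sub>R A l) =
        (\<Sum>l\<le>k. (if l = i then A i else 0) - (if l = j then A j else 0))"
      using ij by (intro sum.cong) auto
    also have "\<dots> = 0" using ij by (simp add: sum_subtractf)
    finally show ?thesis
      using ij by (intro exI[of _ "\<lambda>l. if l = i then 1 else if l = j then - 1 else 0"]) auto
  qed
  then obtain d where d: "(\<Sum>i\<le>k. d i *\<^sub>R A i) = 0" "\<exists>i\<le>k. d i \<noteq> 0" by blast
  define N where "N = (\<Sum>i\<le>k. (d i)\<^sup>2)"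
  have N: "N > 0"
    using d(2) unfolding N_def by (auto intro!: sum_pos2)
  define e where "e = (if d k \<ge> 0 then 1 else - 1) / sqrt N"
  have e: "e\<^sup>2 = 1 / N" using N by (simp add: e_def power_divide)
  show ?thesis
  proof (rule that[of "\<lambda>i. e * d i"])
    show "(\<Sum>i\<le>k. (e * d i) *\<^sub>R A i) = 0"
      using d(1) by (simp flip: scaleR_scaleR scaleR_sum_right)
    show "(\<Sum>i\<le>k. (e * d i)\<^sup>2) = 1"
    proof -
      have "(\<Sum>i\<le>k. (e * d i)\<^sup>2) = e\<^sup>2 * N"
        by (simp add: N_def power_mult_distrib sum_distrib_left)
      then show ?thesis using N by (simp add: e)
    qed
    show "e * d k \<ge> 0" using N by (auto simp: e_def)
  qed
qed

text \<open>
  Let \<open>c\<close> be the unit vector of coefficients of a linear dependency. An orthogonal transformation of the family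
  \<open>A\<close> leaves the sum of squares unchanged, and the Householder reflection that sends \<open>c\<close> to minus the last basis
  vector turns the last member of the family into \<open>0\<close>. The vectors below are the other members of the
  reflected family; \<open>c k \<ge> 0\<close> keeps the denominator away from zero.
\<close>

lemma sum_of_squares_drop_one:
  fixes A :: "nat \<Rightarrow> 'a::euclidean_space"
  assumes "k \<ge> DIM('a)"
  shows "\<exists>B. \<forall>t. (\<Sum>i\<le>k. (A i \<bullet> t)\<^sup>2) = (\<Sum>i<k. (B i \<bullet> t)\<^sup>2)"
proof -
  obtain c where c: "(\<Sum>i\<le>k. c i *\<^sub>R A i) = 0" "(\<Sum>i\<le>k. (c i)\<^sup>2) = 1" "c k \<ge> 0"
    using dependent_family[OF assms] by blast
  define s where "s = - 1 / (1 + c k)"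
  have "(\<Sum>i\<le>k. (A i \<bullet> t)\<^sup>2) = (\<Sum>i<k. ((A i + (s * c i) *\<^sub>R A k) \<bullet> t)\<^sup>2)" for t
  proof -
    have "(\<Sum>i\<le>k. c i * (A i \<bullet> t)) = 0"
      using arg_cong[OF c(1), of "\<lambda>v. v \<bullet> t"] by (simp add: inner_sum_left)
    then have 1: "(\<Sum>i<k. c i * (A i \<bullet> t)) = - c k * (A k \<bullet> t)"
      by (simp add: lessThan_Suc_atMost[symmetric])
    have 2: "(\<Sum>i<k. (c i)\<^sup>2) = 1 - (c k)\<^sup>2"
      using c(2) by (simp add: lessThan_Suc_atMost[symmetric])
    have "(\<Sum>i<k. ((A i + (s * c i) *\<^sub>R A k) \<bullet> t)\<^sup>2) =
        (\<Sum>i<k. (A i \<bullet> t)\<^sup>2 + 2 * s * (A k \<bullet> t) * (c i * (A i \<bullet> t)) + s\<^sup>2 * (A k \<bullet> t)\<^sup>2 * (c i)\<^sup>2)"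
      by (intro sum.cong) (simp_all add: inner_add_left power2_eq_square algebra_simps)
    also have "\<dots> = (\<Sum>i<k. (A i \<bullet> t)\<^sup>2) + 2 * s * (A k \<bullet> t) * (- c k * (A k \<bullet> t))
        + s\<^sup>2 * (A k \<bullet> t)\<^sup>2 * (1 - (c k)\<^sup>2)"
      by (simp only: sum.distrib sum_distrib_left[symmetric] 1 2)
    also have "\<dots> = (\<Sum>i<k. (A i \<bullet> t)\<^sup>2) + (s\<^sup>2 * (1 - (c k)\<^sup>2) - 2 * s * c k) * (A k \<bullet> t)\<^sup>2"
      by (simp add: power2_eq_square algebra_simps)
    also have "s\<^sup>2 * (1 - (c k)\<^sup>2) - 2 * s * c k = 1"
    proof -
      have "s * (1 + c k) = - 1" using c(3) by (simp add: s_def)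
      moreover have "s\<^sup>2 * (1 - (c k)\<^sup>2) - 2 * s * c k = (s * (1 + c k)) * s * (1 - c k) - 2 * s * c k"
        by (simp add: power2_eq_square algebra_simps)
      ultimately show ?thesis by (simp add: algebra_simps)
    qed
    finally show ?thesis
      by (simp add: lessThan_Suc_atMost[symmetric])
  qed
  then show ?thesis by (intro exI[of _ "\<lambda>i. A i + (s * c i) *\<^sub>R A k"]) blast
qed

text \<open>
  The number of squares matters: each of them will carry its own noise, so the variance grows
  with it.
\<close>

lemma sum_of_squares_reduce:
  fixes A :: "nat \<Rightarrow> 'a::euclidean_space"
  assumes "CARD('k::finite) \<ge> DIM('a)"
  shows "\<exists>B :: 'k \<Rightarrow> 'a. \<forall>t. (\<Sum>i<m. (A i \<bullet> t)\<^sup>2) = (\<Sum>i\<in>UNIV. (B i \<bullet> t)\<^sup>2)"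
proof -
  have "\<exists>B. \<forall>t. (\<Sum>i<m. (A i \<bullet> t)\<^sup>2) = (\<Sum>i<CARD('k). (B i \<bullet> t)\<^sup>2)"
  proof (induction m arbitrary: A)
    case 0
    show ?case by (rule exI[of _ "\<lambda>_. 0"]) simp
  next
    case (Suc m)
    show ?case
    proof (cases "m \<ge> DIM('a)")
      case True
      obtain B where B: "\<And>t. (\<Sum>i\<le>m. (A i \<bullet> t)\<^sup>2) = (\<Sum>i<m. (B i \<bullet> t)\<^sup>2)"
        using sum_of_squares_drop_one[OF True] by blast
      obtain C where "\<And>t. (\<Sum>i<m. (B i \<bullet> t)\<^sup>2) = (\<Sum>i<CARD('k). (C i \<bullet> t)\<^sup>2)"
        using Suc.IH by blast
      with B show ?thesis unfolding lessThan_Suc_atMost by metis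
    next
      case False
      show ?thesis
        using False assms
        by (intro exI[of _ "\<lambda>i. if i < Suc m then A i else 0"] allI sum.mono_neutral_cong_left) auto
    qed
  qed
  then obtain B where B: "\<And>t. (\<Sum>i<m. (A i \<bullet> t)\<^sup>2) = (\<Sum>i<CARD('k). (B i \<bullet> t)\<^sup>2)" by blast
  obtain h where h: "bij_betw h (UNIV :: 'k set) {..<CARD('k)}"
    using ex_bij_betw_finite_nat[of "UNIV :: 'k set"] by (auto simp: atLeast0LessThan)
  show ?thesis
    by (intro exI[of _ "B \<circ> h"] allI) (simp add: B sum.reindex_bij_betw[OF h, symmetric])
qed

section \<open>Second moments of bilinear forms on orthonormal pairs\<close>

lemma compact_orthonormal_pairs: "compact (orthonormal_pairs :: ((real^'n) \<times> (real^'n)) set)"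
proof -
  have "closed (variety_I :: ((real^'n) \<times> (real^'n)) set)"
    unfolding variety_I_def split_def by (intro closed_Collect_eq continuous_intros)
  then show ?thesis
    unfolding orthonormal_pairs_def by (intro compact_Int_closed compact_Times) auto
qed

lemma space_invariant_prob: "invariant_prob \<sigma> \<Longrightarrow> space \<sigma> = orthonormal_pairs"
  unfolding invariant_prob_def by (auto simp: space_restrict_space dest: sets_eq_imp_space_eq)

lemma measurable_invariant_prob:
  assumes "invariant_prob \<sigma>" "f \<in> borel_measurable borel"
  shows "f \<in> borel_measurable \<sigma>"
  using assms measurable_restrict_space1[OF assms(2), of orthonormal_pairs]
  by (simp add: invariant_prob_def cong: measurable_cong_sets)

lemma integrable_invariant_prob:
  fixes f :: "(real^'n) \<times> (real^'n) \<Rightarrow> 'b::{banach, second_countable_topology}"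
  assumes \<sigma>: "invariant_prob \<sigma>" and f: "continuous_on UNIV f"
  shows "integrable \<sigma> f"
proof -
  interpret prob_space \<sigma> using \<sigma> by (simp add: invariant_prob_def)
  have "compact (f ` orthonormal_pairs)"
    by (intro compact_continuous_image compact_orthonormal_pairs continuous_on_subset[OF f]) auto
  then obtain C where "\<And>z. z \<in> orthonormal_pairs \<Longrightarrow> norm (f z) \<le> C"
    by (meson compact_imp_bounded bounded_iff imageI)
  then show ?thesis
    using f by (intro integrable_const_bound[where B = C] AE_I2 measurable_invariant_prob[OF \<sigma>]
        borel_measurable_continuous_onI) (auto simp: space_invariant_prob[OF \<sigma>])
qed

lemma integral_rotate:
  fixes f :: "(real^'n) \<times> (real^'n) \<Rightarrow> real"
  assumes \<sigma>: "invariant_prob \<sigma>" and f: "continuous_on UNIV f" and g: "rotation_matrix g"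
  shows "(LINT z|\<sigma>. f (g *v fst z, g *v snd z)) = (LINT z|\<sigma>. f z)"
proof -
  let ?g = "\<lambda>(x, y). (g *v x, g *v y)"
  have orth: "orthogonal_transformation ((*v) g)"
    using g by (simp add: rotation_matrix_def orthogonal_transformation_matrix)
  have "?g \<in> borel_measurable borel"
    unfolding split_def
    by (intro borel_measurable_continuous_onI continuous_on_Pair
        bounded_linear.continuous_on[OF matrix_vector_mul_bounded_linear] continuous_intros)
  moreover have "?g z \<in> orthonormal_pairs" if "z \<in> orthonormal_pairs" for z
    using that orthogonal_transformation_norm[OF orth] orth
    by (auto simp: orthonormal_pairs_def variety_I_def orthogonal_transformation_def)
  ultimately have "?g \<in> measurable \<sigma> (restrict_space borel orthonormal_pairs)"
    using measurable_invariant_prob[OF \<sigma>]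
    by (intro measurable_restrict_space2)
      (auto simp: space_invariant_prob[OF \<sigma>] intro: measurable_invariant_prob[OF \<sigma>])
  then have [measurable]: "?g \<in> measurable \<sigma> \<sigma>"
    using \<sigma> by (simp add: invariant_prob_def cong: measurable_cong_sets)
  have "(LINT z|\<sigma>. f z) = (LINT z|distr \<sigma> \<sigma> ?g. f z)"
    using \<sigma> g by (simp add: invariant_prob_def)
  also have "\<dots> = (LINT z|\<sigma>. f (?g z))"
    by (intro integral_distr measurable_invariant_prob[OF \<sigma>] borel_measurable_continuous_onI f) simp
  finally show ?thesis by (simp add: split_def)
qed

definition plane_rotation :: "'n \<Rightarrow> 'n \<Rightarrow> real \<Rightarrow> real \<Rightarrow> real^'n \<Rightarrow> real^'n" where
  "plane_rotation a b c s x =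
    (\<chi> i. if i = a then c * x $ a + s * x $ b else if i = b then c * x $ b - s * x $ a else x $ i)"

lemma linear_plane_rotation: "linear (plane_rotation a b c s)"
  by (rule linearI) (auto simp: plane_rotation_def vec_eq_iff algebra_simps)

lemma orthogonal_plane_rotation:
  fixes a b :: "'n::finite"
  assumes "a \<noteq> b" "c\<^sup>2 + s\<^sup>2 = 1"
  shows "orthogonal_transformation (plane_rotation a b c s)"
  unfolding orthogonal_transformation
proof (intro conjI allI linear_plane_rotation)
  fix x :: "real^'n"
  let ?R = "plane_rotation a b c s x"
  have split: "v \<bullet> v = v $ a * v $ a + (v $ b * v $ b + (\<Sum>i\<in>UNIV - {a} - {b}. v $ i * v $ i))" for v :: "real^'n"
    using assms(1) unfolding inner_vec_def inner_real_def
    by (subst sum.remove[of _ a]; simp?) (subst sum.remove[of _ b]; simp)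
  have "?R $ a * ?R $ a + ?R $ b * ?R $ b = (c\<^sup>2 + s\<^sup>2) * (x $ a * x $ a + x $ b * x $ b)"
    using assms(1) by (simp add: plane_rotation_def power2_eq_square algebra_simps)
  moreover have "(\<Sum>i\<in>UNIV - {a} - {b}. ?R $ i * ?R $ i) = (\<Sum>i\<in>UNIV - {a} - {b}. x $ i * x $ i)"
    by (intro sum.cong) (auto simp: plane_rotation_def)
  ultimately have "?R \<bullet> ?R = x \<bullet> x"
    using assms(2) by (simp add: split)
  then show "norm ?R = norm x" by (simp add: norm_eq_sqrt_inner)
qed

lemma plane_rotation_double:
  "a \<noteq> b \<Longrightarrow> plane_rotation a b (c * c - s * s) (2 * (s * c)) = plane_rotation a b c s \<circ> plane_rotation a b c s"
  by (auto simp: fun_eq_iff vec_eq_iff plane_rotation_def algebra_simps)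

text \<open>
  A plane rotation is the square of the rotation by half the angle, whose determinant is \<open>1\<close> or \<open>-1\<close>;
  this avoids computing a determinant.
\<close>

lemma rotation_matrix_plane_rotation:
  fixes a b :: "'n::finite"
  assumes ab: "a \<noteq> b" and "c\<^sup>2 + s\<^sup>2 = 1"
  shows "rotation_matrix (matrix (plane_rotation a b c s))"
proof -
  obtain \<theta> where \<theta>: "c = cos \<theta>" "s = sin \<theta>"
    using sincos_total_2pi[OF assms(2)] by metis
  define h where "h = plane_rotation a b (cos (\<theta> / 2)) (sin (\<theta> / 2))"
  have h: "orthogonal_transformation h"
    unfolding h_def by (intro orthogonal_plane_rotation ab) (simp add: add.commute)
  have "plane_rotation a b c s = h \<circ> h"
    using cos_double[of "\<theta> / 2"] sin_double[of "\<theta> / 2"]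
    unfolding h_def plane_rotation_double[OF ab, symmetric]
    by (simp add: \<theta> power2_eq_square mult.assoc)
  moreover have "matrix (h \<circ> h) = matrix h ** matrix h"
    using h by (intro matrix_compose) (auto simp: orthogonal_transformation_def)
  moreover have "det (matrix h) = 1 \<or> det (matrix h) = -1"
    using h det_orthogonal_matrix[of "matrix h"] by (auto simp: orthogonal_transformation_matrix)
  moreover have "orthogonal_matrix (matrix (plane_rotation a b c s))"
    using orthogonal_plane_rotation[OF assms] by (simp add: orthogonal_transformation_matrix)
  ultimately show ?thesis
    by (auto simp: rotation_matrix_def det_mul)
qed

lemma integral_plane_rotation:
  fixes f :: "(real^'n) \<times> (real^'n) \<Rightarrow> real"
  assumes \<sigma>: "invariant_prob \<sigma>" and f: "continuous_on UNIV f" and "a \<noteq> b" "c\<^sup>2 + s\<^sup>2 = 1"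
  shows "(LINT z|\<sigma>. f (plane_rotation a b c s (fst z), plane_rotation a b c s (snd z))) = (LINT z|\<sigma>. f z)"
  using integral_rotate[OF \<sigma> f rotation_matrix_plane_rotation[OF assms(3,4)]]
  by (simp add: matrix_works linear_plane_rotation)

definition mixed_moment :: "((real^'n) \<times> (real^'n)) measure \<Rightarrow> 'n \<Rightarrow> 'n \<Rightarrow> 'n \<Rightarrow> 'n \<Rightarrow> real" where
  "mixed_moment \<sigma> i j k l = (LINT z|\<sigma>. fst z $ i * fst z $ j * snd z $ k * snd z $ l)"

lemma mixed_moment_plane_rotation:
  fixes \<sigma> :: "((real^'n) \<times> (real^'n)) measure"
  assumes \<sigma>: "invariant_prob \<sigma>" and "a \<noteq> b" "c\<^sup>2 + s\<^sup>2 = 1"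
  defines "R \<equiv> plane_rotation a b c s"
  shows "mixed_moment \<sigma> i j k l = (LINT z|\<sigma>. R (fst z) $ i * R (fst z) $ j * R (snd z) $ k * R (snd z) $ l)"
  unfolding R_def mixed_moment_def
  by (subst integral_plane_rotation[OF \<sigma> _ assms(2,3), symmetric]) (auto intro!: continuous_intros)

lemma mixed_moment_commute: "mixed_moment \<sigma> i j l k = mixed_moment \<sigma> i j k l"
  by (simp add: mixed_moment_def mult_ac)

lemma exists_third_index:
  fixes p q :: "'n::finite"
  assumes n: "CARD('n) \<ge> 3"
  shows "\<exists>c. c \<noteq> p \<and> c \<noteq> q"
  proof (rule ccontr)
    assume "\<not> ?thesis"
    then have "(UNIV :: 'n set) \<subseteq> {p, q}" by auto
    then have "CARD('n) \<le> card {p, q}" by (intro card_mono) auto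
    also have "\<dots> \<le> 2" by (simp add: card_insert_if)
    finally show False using n by simp
  qed

text \<open>
  If all indices differ, a quarter turn in the plane of \<open>i\<close> and \<open>j\<close> changes the sign of the moment.
  Otherwise two indices agree and the other two, \<open>p\<close> and \<open>r\<close>, are different; then changing the signs of
  \<open>p\<close> and of a coordinate other than \<open>p\<close> and \<open>r\<close> changes the sign of the moment. Such a coordinate exists
  because of \<open>n \<ge> 3\<close>.
\<close>

lemma mixed_moment_eq_0:
  fixes \<sigma> :: "((real^'n) \<times> (real^'n)) measure"
  assumes \<sigma>: "invariant_prob \<sigma>" and n: "CARD('n) \<ge> 3"
    and "\<not> (i = j \<and> k = l)" "\<not> (i = k \<and> j = l)" "\<not> (i = l \<and> j = k)"
  shows "mixed_moment \<sigma> i j k l = 0"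
proof -
  \<comment> \<open>The sign that the half turn in the plane of \<open>a\<close> and \<open>b\<close> gives to the coordinate \<open>i\<close>.\<close>
  define e where "e a b i = (if i = a \<or> i = b then - 1 else 1 :: real)" for a b i :: 'n
  have flip: "mixed_moment \<sigma> i j k l = e a b i * e a b j * e a b k * e a b l * mixed_moment \<sigma> i j k l"
    if "a \<noteq> b" for a b
  proof -
    have "plane_rotation a b (- 1) 0 x $ i = e a b i * x $ i" for x i
      by (simp add: plane_rotation_def e_def)
    then have "mixed_moment \<sigma> i j k l = (LINT z|\<sigma>. (e a b i * e a b j * e a b k * e a b l) *
        (fst z $ i * fst z $ j * snd z $ k * snd z $ l))"
      using mixed_moment_plane_rotation[OF \<sigma> that, of "- 1" 0 i j k l] by (simp add: mult_ac)
    then show ?thesis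
      by (simp only: integral_mult_right_zero mixed_moment_def)
  qed
  show ?thesis
  proof (cases "distinct [i, j, k, l]")
    case True
    then show ?thesis
      using mixed_moment_plane_rotation[OF \<sigma>, of i j 0 1 i j k l]
      by (auto simp: plane_rotation_def mixed_moment_def mult_ac)
  next
    case False
    then consider "i = j" "k \<noteq> l" | "i = k" "j \<noteq> l" | "i = l" "j \<noteq> k"
      | "j = k" "i \<noteq> l" | "j = l" "i \<noteq> k" | "k = l" "i \<noteq> j"
      using assms(3-5) by auto
    then obtain p q where "e p q i * e p q j * e p q k * e p q l = - 1" "p \<noteq> q"
    proof cases
      case 1
      obtain c where "c \<noteq> k" "c \<noteq> l" using exists_third_index[OF n] by blast
      with 1 show ?thesis by (intro that[of k c]) (auto simp: e_def)
    next
      case 2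
      obtain c where "c \<noteq> j" "c \<noteq> l" using exists_third_index[OF n] by blast
      with 2 show ?thesis by (intro that[of j c]) (auto simp: e_def)
    next
      case 3
      obtain c where "c \<noteq> j" "c \<noteq> k" using exists_third_index[OF n] by blast
      with 3 show ?thesis by (intro that[of j c]) (auto simp: e_def)
    next
      case 4
      obtain c where "c \<noteq> i" "c \<noteq> l" using exists_third_index[OF n] by blast
      with 4 show ?thesis by (intro that[of i c]) (auto simp: e_def)
    next
      case 5
      obtain c where "c \<noteq> i" "c \<noteq> k" using exists_third_index[OF n] by blast
      with 5 show ?thesis by (intro that[of i c]) (auto simp: e_def)
    next
      case 6
      obtain c where "c \<noteq> i" "c \<noteq> j" using exists_third_index[OF n] by blast
      with 6 show ?thesis by (intro that[of i c]) (auto simp: e_def)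
    qed
    then show ?thesis using flip[of p q] by simp
  qed
qed

lemma off_diagonal_constant:
  fixes f :: "'n \<Rightarrow> 'n \<Rightarrow> real"
  assumes sym: "\<And>i k. i \<noteq> k \<Longrightarrow> f i k = f k i"
    and row: "\<And>i k l. i \<noteq> k \<Longrightarrow> i \<noteq> l \<Longrightarrow> f i k = f i l"
    and "i \<noteq> k" "i' \<noteq> k'"
  shows "f i k = f i' k'"
  using assms(3,4) sym row by (cases "i = i'") metis+

text \<open>
  Quarter turns show that the moments \<open>A\<close>, \<open>B\<close>, \<open>C\<close> of the three even patterns do not depend on the
  indices, and an eighth of a turn gives \<open>A = B + 2 * C\<close>. The values of \<open>B\<close> and \<open>C\<close> then follow from the
  equations \<open>norm x * norm y = 1\<close> and \<open>x \<bullet> y = 0\<close> on the orthonormal pairs.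
\<close>

lemma mixed_moment_eq:
  fixes \<sigma> :: "((real^'n) \<times> (real^'n)) measure"
  assumes \<sigma>: "invariant_prob \<sigma>" and n3: "CARD('n) \<ge> 3"
  defines "n \<equiv> real CARD('n)"
  defines "d \<equiv> n * (n - 1) * (n + 2)"
  shows "mixed_moment \<sigma> i j k l =
    (of_bool (i = j \<and> k = l) * (n + 1) - of_bool (i = k \<and> j = l) - of_bool (i = l \<and> j = k)) / d"
proof -
  interpret prob_space \<sigma> using \<sigma> by (simp add: invariant_prob_def)
  let ?M = "mixed_moment \<sigma>"
  obtain u v :: 'n where uv: "u \<noteq> v"
    using exists_third_index[OF n3] by blast
  define A where "A = ?M u u u u"
  define B where "B = ?M u u v v"
  define C where "C = ?M u v u v"
  have A: "?M i i i i = A" for i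
    using mixed_moment_plane_rotation[OF \<sigma>, of u i 0 1 i i i i]
    by (cases "u = i") (simp_all add: A_def mixed_moment_def plane_rotation_def)
  have quarter_turn: "?M i j k l = (LINT z|\<sigma>. plane_rotation a b 0 1 (fst z) $ i *
      plane_rotation a b 0 1 (fst z) $ j * plane_rotation a b 0 1 (snd z) $ k * plane_rotation a b 0 1 (snd z) $ l)"
    if "a \<noteq> b" for a b i j k l
    by (rule mixed_moment_plane_rotation[OF \<sigma> that]) simp
  have B: "?M i i k k = B" if "i \<noteq> k" for i k
    unfolding B_def
  proof (rule off_diagonal_constant[of "\<lambda>i k. ?M i i k k", OF _ _ that uv])
    fix i k :: 'n assume "i \<noteq> k"
    then show "?M i i k k = ?M k k i i"
      by (subst quarter_turn[of i k]) (auto simp: mixed_moment_def plane_rotation_def)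
  next
    fix i k l :: 'n assume "i \<noteq> k" "i \<noteq> l"
    then show "?M i i k k = ?M i i l l"
      by (cases "k = l", simp, subst quarter_turn[of k l]) (auto simp: mixed_moment_def plane_rotation_def)
  qed
  have C: "?M i k i k = C" if "i \<noteq> k" for i k
    unfolding C_def
  proof (rule off_diagonal_constant[of "\<lambda>i k. ?M i k i k", OF _ _ that uv])
    fix i k :: 'n assume "i \<noteq> k"
    then show "?M i k i k = ?M k i k i"
      by (simp add: mixed_moment_def mult_ac)
  next
    fix i k l :: 'n assume "i \<noteq> k" "i \<noteq> l"
    then show "?M i k i k = ?M i l i l"
      by (cases "k = l", simp, subst quarter_turn[of k l]) (auto simp: mixed_moment_def plane_rotation_def)
  qed
  have zero: "?M i j k l = 0"
    if "\<not> (i = j \<and> k = l)" "\<not> (i = k \<and> j = l)" "\<not> (i = l \<and> j = k)" for i j k l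
    using mixed_moment_eq_0[OF \<sigma> n3] that by blast
  have int: "integrable \<sigma> (\<lambda>z. fst z $ i * fst z $ j * snd z $ k * snd z $ l)" for i j k l
    by (intro integrable_invariant_prob[OF \<sigma>] continuous_intros)
  have eighth_turn: "A = B + 2 * C"
  proof -
    define c where "c = 1 / sqrt (2::real)"
    have c: "c\<^sup>2 = 1 / 2" by (simp add: c_def power_divide)
    have c4: "c * c * c * c = 1 / 4"
    proof -
      have "c * c * c * c = (c\<^sup>2)\<^sup>2" by (simp add: power2_eq_square)
      then show ?thesis unfolding c by (simp add: power2_eq_square)
    qed
    define P where "P = (\<lambda>i j k l (z :: (real^'n) \<times> (real^'n)).
      fst z $ i * fst z $ j * snd z $ k * snd z $ l)"
    have intP: "integrable \<sigma> (P i j k l)" and MP: "(LINT z|\<sigma>. P i j k l z) = ?M i j k l" for i j k l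
      using int[of i j k l] by (simp_all add: P_def mixed_moment_def)
    let ?S = "\<lambda>f. \<Sum>i\<in>{u, v}. \<Sum>j\<in>{u, v}. \<Sum>k\<in>{u, v}. \<Sum>l\<in>{u, v}. f i j k l :: real"
    have "A = (LINT z|\<sigma>. (c * (fst z $ u) + c * (fst z $ v)) * (c * (fst z $ u) + c * (fst z $ v)) *
        (c * (snd z $ u) + c * (snd z $ v)) * (c * (snd z $ u) + c * (snd z $ v)))"
      using mixed_moment_plane_rotation[OF \<sigma> uv, of c c u u u u] c
      by (simp add: A_def plane_rotation_def)
    also have "\<dots> = (LINT z|\<sigma>. (1 / 4) * ?S (\<lambda>i j k l. P i j k l z))"
    proof (intro Bochner_Integration.integral_cong refl)
      fix z :: "(real^'n) \<times> (real^'n)"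
      have "(c * (fst z $ u) + c * (fst z $ v)) * (c * (fst z $ u) + c * (fst z $ v)) *
        (c * (snd z $ u) + c * (snd z $ v)) * (c * (snd z $ u) + c * (snd z $ v)) =
        (c * c * c * c) * ((fst z $ u + fst z $ v) * (fst z $ u + fst z $ v) *
          (snd z $ u + snd z $ v) * (snd z $ u + snd z $ v))"
        by (simp add: algebra_simps)
      also have "\<dots> = (1 / 4) * ?S (\<lambda>i j k l. P i j k l z)"
        unfolding c4 P_def using uv by (simp add: algebra_simps)
      finally show "(c * (fst z $ u) + c * (fst z $ v)) * (c * (fst z $ u) + c * (fst z $ v)) *
        (c * (snd z $ u) + c * (snd z $ v)) * (c * (snd z $ u) + c * (snd z $ v)) =
        (1 / 4) * ?S (\<lambda>i j k l. P i j k l z)" .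
    qed
    also have "\<dots> = (1 / 4) * ?S ?M"
      using uv by (simp add: intP MP)
    also have "?S ?M = 2 * A + 2 * B + 4 * C"
      using uv A B[of u v] B[of v u] C[of u v] C[of v u]
        mixed_moment_commute[of \<sigma> u v u v] mixed_moment_commute[of \<sigma> v u v u]
      by (simp add: zero)
    finally show ?thesis by simp
  qed
  have M: "?M i j k l = of_bool (i = j \<and> k = l) * B + (of_bool (i = k \<and> j = l) + of_bool (i = l \<and> j = k)) * C"
    for i j k l
  proof -
    consider "i = j" "k = l" "i = k" | "i = j" "k = l" "i \<noteq> k" | "i = k" "j = l" "i \<noteq> j"
      | "i = l" "j = k" "i \<noteq> j" | "\<not> (i = j \<and> k = l)" "\<not> (i = k \<and> j = l)" "\<not> (i = l \<and> j = k)"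
      by blast
    then show ?thesis
    proof cases
      case 1 then show ?thesis using A[of i] eighth_turn by simp
    next
      case 2 then show ?thesis using B[of i k] by simp
    next
      case 3 then show ?thesis using C[of i j] by simp
    next
      case 4
      have "?M i j j i = ?M i j i j" by (rule mixed_moment_commute)
      with 4 show ?thesis using C[of i j] by simp
    next
      case 5
      then have "?M i j k l = 0" by (rule zero)
      moreover have "\<not> (i = k \<and> j = l)" "\<not> (i = l \<and> j = k)" "\<not> (i = j \<and> k = l)" using 5 by blast+
      ultimately show ?thesis by (simp only: of_bool_def if_False mult_zero_left add_0_left)
    qed
  qed
  have mom: "?M i j k l = (LINT z|\<sigma>. fst z $ i * fst z $ j * snd z $ k * snd z $ l)" for i j k l
    by (simp add: mixed_moment_def)
  have one: "(\<Sum>i\<in>UNIV. \<Sum>k\<in>UNIV. ?M i i k k) = 1"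
  proof -
    have "(\<Sum>i\<in>UNIV. \<Sum>k\<in>UNIV. ?M i i k k) = (LINT z|\<sigma>. (fst z \<bullet> fst z) * (snd z \<bullet> snd z))"
    proof -
      have "?M i i k k = (LINT z|\<sigma>. (fst z $ i * fst z $ i) * (snd z $ k * snd z $ k))" for i k
        by (simp add: mom mult_ac)
      moreover have "integrable \<sigma> (\<lambda>z. (fst z $ i * fst z $ i) * (snd z $ k * snd z $ k))" for i k
        by (intro integrable_invariant_prob[OF \<sigma>] continuous_intros)
      ultimately show ?thesis
        unfolding inner_vec_def sum_product inner_real_def
        by (simp add: Bochner_Integration.integral_sum)
    qed
    also have "\<dots> = (LINT z|\<sigma>. 1)"
      by (intro Bochner_Integration.integral_cong)
        (auto simp: space_invariant_prob[OF \<sigma>] orthonormal_pairs_def dot_square_norm)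
    finally show ?thesis by (simp add: prob_space)
  qed
  have nul: "(\<Sum>i\<in>UNIV. \<Sum>k\<in>UNIV. ?M i k i k) = 0"
  proof -
    have "(\<Sum>i\<in>UNIV. \<Sum>k\<in>UNIV. ?M i k i k) = (LINT z|\<sigma>. (fst z \<bullet> snd z) * (fst z \<bullet> snd z))"
    proof -
      have "?M i k i k = (LINT z|\<sigma>. (fst z $ i * snd z $ i) * (fst z $ k * snd z $ k))" for i k
        by (simp add: mom mult_ac)
      moreover have "integrable \<sigma> (\<lambda>z. (fst z $ i * snd z $ i) * (fst z $ k * snd z $ k))" for i k
        by (intro integrable_invariant_prob[OF \<sigma>] continuous_intros)
      ultimately show ?thesis
        unfolding inner_vec_def sum_product inner_real_def
        by (simp add: Bochner_Integration.integral_sum)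
    qed
    also have "\<dots> = (LINT z|\<sigma>. 0)"
      by (intro Bochner_Integration.integral_cong)
        (auto simp: space_invariant_prob[OF \<sigma>] orthonormal_pairs_def variety_I_def inner_commute)
    finally show ?thesis by simp
  qed
  have "(\<Sum>k::'n\<in>UNIV. a + b * of_bool (i = k)) = n * a + b" for a b i
  proof -
    have "(\<Sum>k::'n\<in>UNIV. of_bool (i = k)) = (1 :: real)" by (simp add: of_bool_def)
    then show ?thesis by (simp only: sum.distrib sum_distrib_left[symmetric]) (simp add: n_def)
  qed
  then have sums: "(\<Sum>i::'n\<in>UNIV. \<Sum>k::'n\<in>UNIV. a + b * of_bool (i = k)) = n\<^sup>2 * a + n * b" for a b
    by (simp add: n_def power2_eq_square algebra_simps)
  have "?M i i k k = B + (2 * C) * of_bool (i = k)" for i k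
    by (simp add: M[of i i k k])
  with one have "(\<Sum>i::'n\<in>UNIV. \<Sum>k::'n\<in>UNIV. B + (2 * C) * of_bool (i = k)) = 1" by simp
  then have 1: "n\<^sup>2 * B + 2 * n * C = 1"
    unfolding sums by simp
  have "?M i k i k = C + (B + C) * of_bool (i = k)" for i k
    by (simp add: M[of i k i k])
  with nul have "(\<Sum>i::'n\<in>UNIV. \<Sum>k::'n\<in>UNIV. C + (B + C) * of_bool (i = k)) = 0" by simp
  then have 2: "n * B + (n\<^sup>2 + n) * C = 0"
    unfolding sums by (simp add: algebra_simps)
  have n: "n \<ge> 3" using n3 by (simp add: n_def)
  have BC: "B = - (n + 1) * C"
  proof -
    have "n * (B + (n + 1) * C) = n * B + (n\<^sup>2 + n) * C" by (simp add: power2_eq_square algebra_simps)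
    then have "B + (n + 1) * C = 0" using 2 n by simp
    then show ?thesis by (simp add: algebra_simps)
  qed
  have "- d * C = 1"
    using 1 unfolding BC d_def by (simp add: power2_eq_square algebra_simps)
  moreover have "d > 0" using n by (simp add: d_def)
  ultimately have C': "C = - 1 / d" by (simp add: field_simps)
  have B': "B = (n + 1) / d" unfolding BC C' using \<open>d > 0\<close> by (simp add: field_simps)
  have "x * ((n + 1) / d) + (y + w) * (- 1 / d) = (x * (n + 1) - y - w) / d" for x y w :: real
    using \<open>d > 0\<close> by (simp add: field_simps)
  then show ?thesis
    unfolding M B' C' .
qed

text \<open>
  The bilinear forms in \<open>(x, y)\<close> are the functions \<open>\<lambda>z. a \<bullet> tensor z\<close>, where \<open>a\<close> is the matrix of
  coefficients, stored as a vector indexed by pairs.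
\<close>

definition tensor :: "(real^'n) \<times> (real^'n) \<Rightarrow> real^('n \<times> 'n)" where
  "tensor z = (\<chi> p. fst z $ fst p * snd z $ snd p)"

lemma continuous_on_tensor [continuous_intros]: "continuous_on S tensor"
  unfolding tensor_def by (intro continuous_intros)

lemma sum_UNIV_prod: "(\<Sum>p\<in>UNIV. f p) = (\<Sum>i\<in>UNIV. \<Sum>k\<in>UNIV. f (i::'a::finite, k::'b::finite))"
  by (simp add: sum.cartesian_product)

lemma norm_tensor: "norm (tensor z) = norm (fst z) * norm (snd z)"
proof -
  have "tensor z \<bullet> tensor z = (fst z \<bullet> fst z) * (snd z \<bullet> snd z)"
    unfolding inner_vec_def sum_product sum_UNIV_prod by (simp add: tensor_def mult_ac)
  then show ?thesis by (simp add: norm_eq_sqrt_inner real_sqrt_mult)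
qed

text \<open>
  Expanding with the moments above, the second moment is a combination of \<open>(norm a)\<^sup>2\<close>, the squared
  trace, and the inner product of \<open>a\<close> with its transpose. The last one is at most \<open>(norm a)\<^sup>2\<close>
  by Cauchy--Schwarz, with equality for symmetric matrices.
\<close>

lemma traceless_norm_le:
  fixes \<sigma> :: "((real^'n) \<times> (real^'n)) measure" and a :: "real^('n \<times> 'n)"
  assumes \<sigma>: "invariant_prob \<sigma>" and n3: "CARD('n) \<ge> 3" and tr: "(\<Sum>i\<in>UNIV. a $ (i, i)) = 0"
  defines "n \<equiv> real CARD('n)"
  shows "(norm a)\<^sup>2 \<le> (n\<^sup>2 + n - 2) * (LINT z|\<sigma>. (a \<bullet> tensor z)\<^sup>2)"
proof -
  let ?M = "mixed_moment \<sigma>"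
  define d where "d = n * (n - 1) * (n + 2)"
  have n: "n \<ge> 3" using n3 by (simp add: n_def)
  then have d: "d > 0" by (simp add: d_def)
  have int: "integrable \<sigma> (\<lambda>z. fst z $ i * fst z $ j * snd z $ k * snd z $ l)" for i j k l
    by (intro integrable_invariant_prob[OF \<sigma>] continuous_intros)
  have trace: "(\<Sum>p\<in>UNIV. a $ p * of_bool (fst p = snd p)) = (\<Sum>i\<in>UNIV. a $ (i, i))"
    unfolding sum_UNIV_prod by (simp add: of_bool_def if_distrib cong: if_cong)
  have "(LINT z|\<sigma>. (a \<bullet> tensor z)\<^sup>2) = (LINT z|\<sigma>. (\<Sum>p\<in>UNIV. \<Sum>q\<in>UNIV.
      a $ p * a $ q * (fst z $ fst p * fst z $ fst q * snd z $ snd p * snd z $ snd q)))"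
    by (simp add: power2_eq_square inner_vec_def tensor_def sum_product mult_ac)
  also have "\<dots> = (\<Sum>p\<in>UNIV. \<Sum>q\<in>UNIV. a $ p * a $ q * ?M (fst p) (fst q) (snd p) (snd q))"
    by (simp add: int mixed_moment_def Bochner_Integration.integral_sum)
  also have "\<dots> = (\<Sum>p\<in>UNIV. \<Sum>q\<in>UNIV. (a $ p * a $ q *
      (of_bool (p = q) * (n + 1) - of_bool (fst p = snd p) * of_bool (fst q = snd q) - of_bool (q = prod.swap p))) / d)"
  proof (intro sum.cong refl)
    fix p q :: "'n \<times> 'n"
    have "(fst p = fst q \<and> snd p = snd q) = (p = q)" "(fst p = snd q \<and> fst q = snd p) = (q = prod.swap p)"
      by (auto simp: prod_eq_iff)
    then show "a $ p * a $ q * ?M (fst p) (fst q) (snd p) (snd q) = (a $ p * a $ q *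
      (of_bool (p = q) * (n + 1) - of_bool (fst p = snd p) * of_bool (fst q = snd q) - of_bool (q = prod.swap p))) / d"
      by (simp only: mixed_moment_eq[OF \<sigma> n3] n_def[symmetric] d_def[symmetric] of_bool_conj times_divide_eq_right)
  qed
  also have "\<dots> = ((n + 1) * (\<Sum>p\<in>UNIV. \<Sum>q\<in>UNIV. a $ p * a $ q * of_bool (p = q))
      - (\<Sum>p\<in>UNIV. \<Sum>q\<in>UNIV. (a $ p * of_bool (fst p = snd p)) * (a $ q * of_bool (fst q = snd q)))
      - (\<Sum>p\<in>UNIV. \<Sum>q\<in>UNIV. a $ p * a $ q * of_bool (q = prod.swap p))) / d"
    unfolding sum_divide_distrib[symmetric] sum_distrib_left sum_subtractf[symmetric]
    by (intro arg_cong2[where f = "(/)"] sum.cong refl) (simp only: right_diff_distrib mult_ac)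
  also have "(\<Sum>p\<in>UNIV. \<Sum>q\<in>UNIV. (a $ p * of_bool (fst p = snd p)) * (a $ q * of_bool (fst q = snd q))) = 0"
    unfolding sum_product[symmetric] using tr trace by simp
  also have "(\<Sum>p\<in>UNIV. \<Sum>q\<in>UNIV. a $ p * a $ q * of_bool (p = q)) = (\<Sum>p\<in>UNIV. a $ p * a $ p)"
    by (intro sum.cong refl) (simp add: of_bool_def if_distrib cong: if_cong)
  also have "(\<Sum>p\<in>UNIV. \<Sum>q\<in>UNIV. a $ p * a $ q * of_bool (q = prod.swap p)) = (\<Sum>p\<in>UNIV. a $ p * a $ prod.swap p)"
    by (intro sum.cong refl) (simp add: of_bool_def if_distrib cong: if_cong)
  finally have eq: "d * (LINT z|\<sigma>. (a \<bullet> tensor z)\<^sup>2) =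
      (n + 1) * (norm a)\<^sup>2 - (\<Sum>p\<in>UNIV. a $ p * a $ prod.swap p)"
    using d by (simp add: power2_norm_eq_inner inner_vec_def)
  have "(\<Sum>p\<in>UNIV. a $ p * a $ prod.swap p) = a \<bullet> (\<chi> p. a $ prod.swap p)"
    by (simp add: inner_vec_def)
  also have "\<dots> \<le> norm a * norm (\<chi> p. a $ prod.swap p)"
    by (rule norm_cauchy_schwarz)
  also have "norm (\<chi> p. a $ prod.swap p) = norm a"
    unfolding norm_eq_sqrt_inner inner_vec_def sum_UNIV_prod
    by (subst sum.swap) simp
  finally have "n * (norm a)\<^sup>2 \<le> n * ((n\<^sup>2 + n - 2) * (LINT z|\<sigma>. (a \<bullet> tensor z)\<^sup>2))"
    using eq by (simp add: d_def power2_eq_square algebra_simps)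
  then show ?thesis using n by simp
qed

section \<open>Sums of squares as functions on orthonormal pairs\<close>

lemma bihom_1_1_tensor:
  assumes "p \<in> bihom 1 1"
  shows "\<exists>a. \<forall>z. poly_eval p z = a \<bullet> tensor z"
proof -
  have "\<exists>q. \<forall>z. monom_eval m z = axis q 1 \<bullet> tensor z" if "m \<in> Poly_Mapping.keys p" for m
  proof -
    have "(\<Sum>i\<in>UNIV. Poly_Mapping.lookup m (Inl i)) = 1" "(\<Sum>i\<in>UNIV. Poly_Mapping.lookup m (Inr i)) = 1"
      using assms that by (auto simp: bihom_def)
    then obtain i j where "Poly_Mapping.lookup m (Inl i) = 1" "\<forall>k. i \<noteq> k \<longrightarrow> Poly_Mapping.lookup m (Inl k) = 0"
      "Poly_Mapping.lookup m (Inr j) = 1" "\<forall>k. j \<noteq> k \<longrightarrow> Poly_Mapping.lookup m (Inr k) = 0"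
      unfolding sum_eq_1_iff[OF finite] by blast
    then have e: "Poly_Mapping.lookup m (Inl k) = (if k = i then 1 else 0)"
      "Poly_Mapping.lookup m (Inr k) = (if k = j then 1 else 0)" for k
      by auto
    have "monom_eval m z = axis (i, j) 1 \<bullet> tensor z" for z
      by (simp add: monom_eval_def e inner_axis' tensor_def if_distrib prod.delta cong: if_cong)
    then show ?thesis by blast
  qed
  then obtain q where q: "\<And>m z. m \<in> Poly_Mapping.keys p \<Longrightarrow> monom_eval m z = axis (q m) 1 \<bullet> tensor z"
    by metis
  have "poly_eval p z = (\<Sum>m\<in>Poly_Mapping.keys p. Poly_Mapping.lookup p m *\<^sub>R axis (q m) 1) \<bullet> tensor z" for z
    by (simp add: poly_eval_def q inner_sum_left)
  then show ?thesis by blast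
qed

text \<open>
  The identity matrix represents \<open>x \<bullet> y\<close>, which vanishes on the variety.
\<close>

lemma traceless_representative:
  fixes a :: "real^('n::finite \<times> 'n)"
  shows "\<exists>b. (\<Sum>i\<in>UNIV. b $ (i, i)) = 0 \<and> (\<forall>z\<in>variety_I. b \<bullet> tensor z = a \<bullet> tensor z)"
proof -
  define e :: "real^('n \<times> 'n)" where "e = (\<chi> p. of_bool (fst p = snd p))"
  define c where "c = (\<Sum>i\<in>UNIV. a $ (i, i)) / CARD('n)"
  have "e \<bullet> tensor z = snd z \<bullet> fst z" for z
    unfolding inner_commute[of e] inner_commute[of "snd z"] inner_vec_def[of "tensor z"] inner_vec_def[of "fst z"] sum_UNIV_prod
    by (simp add: e_def tensor_def of_bool_def if_distrib cong: if_cong)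
  then have "\<forall>z\<in>variety_I. (a - c *\<^sub>R e) \<bullet> tensor z = a \<bullet> tensor z"
    by (auto simp: inner_diff_left variety_I_def)
  moreover have "(\<Sum>i\<in>UNIV. (a - c *\<^sub>R e) $ (i, i)) = 0"
    by (simp add: e_def sum_subtractf c_def)
  ultimately show ?thesis by blast
qed

lemma poly_eval_scaleR: "poly_eval (c *\<^sub>R p) z = c * poly_eval p z"
proof (induction p rule: poly_induct_single)
  case zero
  then show ?case by simp
next
  case (single p m a)
  have "c *\<^sub>R Poly_Mapping.single m a = Poly_Mapping.single m (c * a)"
    by (rule poly_mapping_eqI) (simp add: lookup_scaleR_poly lookup_single when_def)
  then show ?case
    by (simp add: single scaleR_add_right poly_eval_add poly_eval_single distrib_left)
qed

lemma quot_eval_add: "z \<in> variety_I \<Longrightarrow> quot_eval (f + g) z = quot_eval f z + quot_eval g z"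
  by transfer (simp add: poly_eval_add)

lemma quot_eval_scaleR: "z \<in> variety_I \<Longrightarrow> quot_eval (c *\<^sub>R f) z = c * quot_eval f z"
  by transfer (simp add: poly_eval_scaleR)

lemma quot_eval_sum:
  assumes z: "z \<in> variety_I" and "finite I"
  shows "quot_eval (\<Sum>i\<in>I. f i) z = (\<Sum>i\<in>I. quot_eval (f i) z)"
  using assms(2)
proof (induction I rule: finite_induct)
  case empty
  then show ?case using quot_eval_scaleR[OF z, of 0 0] by simp
qed (simp add: quot_eval_add[OF z])

lemma quot_eval_norm_form: "z \<in> orthonormal_pairs \<Longrightarrow> quot_eval norm_form z = 1"
proof -
  assume z: "z \<in> orthonormal_pairs"
  have "(\<Sum>i\<in>UNIV. (fst z $ i)\<^sup>2) = 1" "(\<Sum>i\<in>UNIV. (snd z $ i)\<^sup>2) = 1"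
    using z by (auto simp: orthonormal_pairs_def norm_vec_def L2_set_def)
  then have "poly_eval ((\<Sum>i\<in>UNIV. (var_x i)^2) * (\<Sum>i\<in>UNIV. (var_y i)^2)) z = 1"
    by (simp add: poly_eval_mult poly_eval_sum power2_eq_square poly_eval_var_x poly_eval_var_y)
  moreover have "z \<in> variety_I" using z by (simp add: orthonormal_pairs_def)
  ultimately show ?thesis by transfer simp
qed

lemma quot_eval_continuous:
  fixes f :: "('n::finite) quot"
  shows "\<exists>h. continuous_on UNIV h \<and> (\<forall>z\<in>variety_I. quot_eval f z = h z)"
proof -
  have "continuous_on UNIV (poly_eval p)" for p :: "'n xypoly"
    unfolding poly_eval_def[abs_def] monom_eval_def by (intro continuous_intros)
  then show ?thesis
    by transfer (auto intro!: exI[of _ "poly_eval _"])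
qed

lemma Sos_sum_of_squares:
  assumes "f \<in> Sos"
  shows "\<exists>(k::nat) a. \<forall>z\<in>variety_I. quot_eval f z = (\<Sum>i<k. (a i \<bullet> tensor z)\<^sup>2)"
proof -
  obtain p where p: "f = abs_quot p" "p \<in> bihom 2 2"
    and ex: "\<exists>(k::nat) q. (\<forall>i<k. q i \<in> bihom 1 1) \<and> p - (\<Sum>i<k. (q i)^2) \<in> ideal_I"
    using assms unfolding Sos_def by blast
  then obtain k :: nat and q where
    q: "\<And>i. i < k \<Longrightarrow> q i \<in> bihom 1 1" and pq: "p - (\<Sum>i<k. (q i)^2) \<in> ideal_I"
    by blast
  obtain a where a: "\<And>i z. i < k \<Longrightarrow> poly_eval (q i) z = a i \<bullet> tensor z"
    using bihom_1_1_tensor[OF q] by metis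
  have "quot_eval f z = (\<Sum>i<k. (a i \<bullet> tensor z)\<^sup>2)" if z: "z \<in> variety_I" for z
  proof -
    have "quot_eval f z = poly_eval p z"
      using p z by (simp add: quot_eval.abs_eq quot_rel_def ideal_I_0)
    also have "\<dots> = poly_eval (p - (\<Sum>i<k. (q i)^2)) z + poly_eval (\<Sum>i<k. (q i)^2) z"
      by (simp flip: poly_eval_add)
    also have "\<dots> = (\<Sum>i<k. (a i \<bullet> tensor z)\<^sup>2)"
      using poly_eval_ideal_I[OF pq z] by (simp add: poly_eval_sum power2_eq_square poly_eval_mult a)
    finally show ?thesis .
  qed
  then show ?thesis by blast
qed

text \<open>
  Each square is the square of a bilinear form with traceless matrix, at most \<open>n\<^sup>2\<close> of them are needed,
  and since their sum has integral \<open>1\<close>, the second moment bound controls the size of the matrices.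
\<close>

lemma Sos_tilde_representation:
  fixes \<sigma> :: "((real^'n) \<times> (real^'n)) measure"
  assumes \<sigma>: "invariant_prob \<sigma>" and n3: "CARD('n) \<ge> 3" and f: "f \<in> Sos_tilde \<sigma>"
  defines "n \<equiv> real CARD('n)"
  shows "\<exists>a :: 'n \<times> 'n \<Rightarrow> real^('n \<times> 'n).
    (\<forall>z\<in>orthonormal_pairs. quot_eval f z + 1 = (\<Sum>i\<in>UNIV. (a i \<bullet> tensor z)\<^sup>2)) \<and>
    (\<Sum>i\<in>UNIV. (norm (a i))\<^sup>2) \<le> n\<^sup>2 + n - 2"
proof -
  have T: "orthonormal_pairs \<subseteq> (variety_I :: ((real^'n) \<times> (real^'n)) set)"
    by (auto simp: orthonormal_pairs_def)
  have f': "f + norm_form \<in> Sos" "(LINT z|\<sigma>. quot_eval (f + norm_form) z) = 1"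
    using f by (auto simp: Sos_tilde_def hyperplane_H_def)
  obtain k a where a: "\<And>z. z \<in> variety_I \<Longrightarrow> quot_eval (f + norm_form) z = (\<Sum>i<k::nat. (a i \<bullet> tensor z)\<^sup>2)"
    using Sos_sum_of_squares[OF f'(1)] by blast
  obtain b :: "'n \<times> 'n \<Rightarrow> real^('n \<times> 'n)"
    where b: "\<And>t. (\<Sum>i<k. (a i \<bullet> t)\<^sup>2) = (\<Sum>i\<in>UNIV. (b i \<bullet> t)\<^sup>2)"
    using sum_of_squares_reduce[where 'k="'n \<times> 'n" and 'a="real^('n \<times> 'n)" and A=a and m=k] by auto
  have "\<exists>c. \<forall>i. (\<Sum>j\<in>UNIV. c i $ (j, j)) = 0 \<and> (\<forall>z\<in>variety_I. c i \<bullet> tensor z = b i \<bullet> tensor z)"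
    by (intro choice allI traceless_representative)
  then obtain c where c: "\<And>i. (\<Sum>j\<in>UNIV. c i $ (j, j)) = 0"
      "\<And>i z. z \<in> variety_I \<Longrightarrow> c i \<bullet> tensor z = b i \<bullet> tensor z"
    by blast
  have eq: "quot_eval (f + norm_form) z = (\<Sum>i\<in>UNIV. (c i \<bullet> tensor z)\<^sup>2)"
    if "z \<in> orthonormal_pairs" for z
  proof -
    have "z \<in> variety_I" using T that by blast
    then show ?thesis by (simp only: a b c)
  qed
  have "(\<Sum>i\<in>UNIV. (norm (c i))\<^sup>2) \<le> (\<Sum>i\<in>UNIV. (n\<^sup>2 + n - 2) * (LINT z|\<sigma>. (c i \<bullet> tensor z)\<^sup>2))"
    unfolding n_def by (intro sum_mono traceless_norm_le \<sigma> n3 c(1))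
  also have "\<dots> = (n\<^sup>2 + n - 2) * (LINT z|\<sigma>. (\<Sum>i\<in>UNIV. (c i \<bullet> tensor z)\<^sup>2))"
    by (subst Bochner_Integration.integral_sum)
      (auto intro!: integrable_invariant_prob[OF \<sigma>] continuous_intros simp: sum_distrib_left)
  also have "(LINT z|\<sigma>. (\<Sum>i\<in>UNIV. (c i \<bullet> tensor z)\<^sup>2)) = (LINT z|\<sigma>. quot_eval (f + norm_form) z)"
    by (intro Bochner_Integration.integral_cong) (auto simp: space_invariant_prob[OF \<sigma>] eq)
  finally have "(\<Sum>i\<in>UNIV. (norm (c i))\<^sup>2) \<le> n\<^sup>2 + n - 2" by (simp add: f')
  moreover have "quot_eval f z + 1 = (\<Sum>i\<in>UNIV. (c i \<bullet> tensor z)\<^sup>2)" if "z \<in> orthonormal_pairs" for z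
  proof -
    have "z \<in> variety_I" using T that by blast
    then show ?thesis using eq[OF that] by (simp only: quot_eval_add quot_eval_norm_form[OF that])
  qed
  ultimately show ?thesis by blast
qed

section \<open>Approximating sums of squares by Gaussian sums of squares\<close>

text \<open>
  In the coordinates \<open>u\<close> that \<open>\<phi>\<close> provides, evaluation at an orthonormal pair \<open>z\<close> is a linear functional
  of \<open>u\<close>, hence the inner product with a vector \<open>\<Phi> z\<close>. The remaining conditions say that \<open>\<phi>\<close> is an
  isometry into the functions of mean zero. The vector integral of \<open>h z *\<^sub>R \<Phi> z\<close> is then the coordinate vector of the
  orthogonal projection of \<open>h\<close> to the range of \<open>\<phi>\<close>.
\<close>

definition evaluation_vector ::
    "((real^'n) \<times> (real^'n)) measure \<Rightarrow> (real^'d \<Rightarrow> 'n quot) \<Rightarrow> ((real^'n) \<times> (real^'n) \<Rightarrow> real^'d) \<Rightarrow> bool" where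
  "evaluation_vector \<sigma> \<phi> \<Phi> \<longleftrightarrow> continuous_on UNIV \<Phi> \<and>
    (\<forall>z\<in>orthonormal_pairs. \<forall>u. quot_eval (\<phi> u) z = u \<bullet> \<Phi> z) \<and>
    (\<forall>u v. (LINT z|\<sigma>. (u \<bullet> \<Phi> z) * (v \<bullet> \<Phi> z)) = u \<bullet> v) \<and> (LINT z|\<sigma>. \<Phi> z) = 0"

lemma evaluation_vector_exists:
  fixes \<sigma> :: "((real^'n) \<times> (real^'n)) measure" and \<phi> :: "real^'d \<Rightarrow> 'n quot"
  assumes \<sigma>: "invariant_prob \<sigma>" and \<phi>: "linear_isometry_M \<sigma> \<phi>"
  shows "\<exists>\<Phi>. evaluation_vector \<sigma> \<phi> \<Phi>"
proof -
  have lin: "linear \<phi>" and range: "range \<phi> = space_M \<sigma>"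
    and iso: "inner_M \<sigma> (\<phi> u) (\<phi> v) = u \<bullet> v" for u v
    using \<phi> by (auto simp: linear_isometry_M_def)
  have "\<exists>h. \<forall>b::real^'d. continuous_on UNIV (h b) \<and> (\<forall>z\<in>variety_I. quot_eval (\<phi> b) z = h b z)"
    by (intro choice allI quot_eval_continuous)
  then obtain h :: "real^'d \<Rightarrow> _ \<Rightarrow> real" where h: "\<And>b. continuous_on UNIV (h b)"
    "\<And>b z. z \<in> variety_I \<Longrightarrow> quot_eval (\<phi> b) z = h b z"
    by blast
  define \<Phi> where "\<Phi> = (\<lambda>z. \<Sum>b\<in>Basis. h b z *\<^sub>R b)"
  have cont: "continuous_on UNIV \<Phi>"
    unfolding \<Phi>_def by (intro continuous_intros h)
  have eval: "quot_eval (\<phi> u) z = u \<bullet> \<Phi> z" if "z \<in> orthonormal_pairs" for u z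
  proof -
    have z: "z \<in> variety_I" using that by (simp add: orthonormal_pairs_def)
    have "quot_eval (\<phi> u) z = quot_eval (\<phi> (\<Sum>b\<in>Basis. (u \<bullet> b) *\<^sub>R b)) z"
      by (simp only: euclidean_representation)
    also have "\<dots> = (\<Sum>b\<in>Basis. (u \<bullet> b) * h b z)"
      by (simp add: linear_sum[OF lin] linear_scale[OF lin] quot_eval_sum[OF z] quot_eval_scaleR[OF z] h(2)[OF z])
    also have "\<dots> = u \<bullet> \<Phi> z"
      by (simp add: \<Phi>_def inner_sum_right mult.commute)
    finally show ?thesis .
  qed
  have "(LINT z|\<sigma>. (u \<bullet> \<Phi> z) * (v \<bullet> \<Phi> z)) = u \<bullet> v" for u v
  proof -
    have "(LINT z|\<sigma>. (u \<bullet> \<Phi> z) * (v \<bullet> \<Phi> z)) = inner_M \<sigma> (\<phi> u) (\<phi> v)"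
      unfolding inner_M_def
      by (intro Bochner_Integration.integral_cong) (auto simp: space_invariant_prob[OF \<sigma>] eval)
    then show ?thesis by (simp add: iso)
  qed
  moreover have "(LINT z|\<sigma>. \<Phi> z) = 0"
  proof -
    have "u \<bullet> (LINT z|\<sigma>. \<Phi> z) = 0" for u
    proof -
      have "u \<bullet> (LINT z|\<sigma>. \<Phi> z) = (LINT z|\<sigma>. u \<bullet> \<Phi> z)"
        by (simp add: integrable_invariant_prob[OF \<sigma> cont])
      also have "\<dots> = (LINT z|\<sigma>. quot_eval (\<phi> u) z)"
        by (intro Bochner_Integration.integral_cong) (auto simp: space_invariant_prob[OF \<sigma>] eval)
      also have "\<dots> = 0" using range by (auto simp: space_M_def)
      finally show ?thesis .
    qed
    then show ?thesis by (metis inner_eq_zero_iff)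
  qed
  ultimately show ?thesis
    using cont eval by (auto simp: evaluation_vector_def)
qed

lemma evaluation_vector_Bessel:
  fixes \<sigma> :: "((real^'n) \<times> (real^'n)) measure"
  assumes \<sigma>: "invariant_prob \<sigma>" and \<Phi>: "evaluation_vector \<sigma> \<phi> \<Phi>" and h: "continuous_on UNIV h"
  shows "(norm (LINT z|\<sigma>. h z *\<^sub>R \<Phi> z))\<^sup>2 \<le> (LINT z|\<sigma>. (h z)\<^sup>2)"
proof -
  have cont: "continuous_on UNIV \<Phi>"
    and iso: "\<And>u v. (LINT z|\<sigma>. (u \<bullet> \<Phi> z) * (v \<bullet> \<Phi> z)) = u \<bullet> v"
    using \<Phi> by (auto simp: evaluation_vector_def)
  define w where "w = (LINT z|\<sigma>. h z *\<^sub>R \<Phi> z)"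
  have int: "integrable \<sigma> (\<lambda>z. h z *\<^sub>R \<Phi> z)" "integrable \<sigma> (\<lambda>z. (h z)\<^sup>2)"
    "integrable \<sigma> (\<lambda>z. h z * (w \<bullet> \<Phi> z))" "integrable \<sigma> (\<lambda>z. (w \<bullet> \<Phi> z) * (w \<bullet> \<Phi> z))"
    by (intro integrable_invariant_prob[OF \<sigma>] continuous_intros h cont)+
  have "(LINT z|\<sigma>. h z * (w \<bullet> \<Phi> z)) = (LINT z|\<sigma>. w \<bullet> (h z *\<^sub>R \<Phi> z))" by simp
  also have "\<dots> = w \<bullet> w" unfolding w_def by (rule integral_inner_right) (rule int)
  finally have cross: "(LINT z|\<sigma>. h z * (w \<bullet> \<Phi> z)) = w \<bullet> w" .
  have "0 \<le> (LINT z|\<sigma>. (h z - w \<bullet> \<Phi> z)\<^sup>2)" by simp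
  also have "\<dots> = (LINT z|\<sigma>. (h z)\<^sup>2 - 2 * (h z * (w \<bullet> \<Phi> z)) + (w \<bullet> \<Phi> z) * (w \<bullet> \<Phi> z))"
    by (intro Bochner_Integration.integral_cong refl) (simp add: power2_eq_square algebra_simps)
  also have "\<dots> = (LINT z|\<sigma>. (h z)\<^sup>2) - w \<bullet> w"
    by (simp add: int cross iso)
  finally show ?thesis by (simp add: w_def power2_norm_eq_inner)
qed

text \<open>
  \<open>\<psi> q\<close> projects the sum of the squares of the bilinear forms with matrices \<open>\<tau> q\<^sub>i\<close>. The point
  \<open>u\<close> is the image of some \<open>q\<close>, and adding noise \<open>g\<close> to \<open>q\<close> shifts the mean of the sum of squares
  by the constant \<open>n\<^sup>2 \<tau>\<^sup>2\<close> only, because \<open>norm (tensor z) = 1\<close>; the projection kills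
  constants. By Bessel's inequality it remains to integrate the variance over the orthonormal pairs, where it
  equals \<open>4 \<tau>\<^sup>2 \<Sum>\<^sub>i (a\<^sub>i \<bullet> tensor z)\<^sup>2 + 2 n\<^sup>2 \<tau>\<^sup>4\<close>, and the sum has integral \<open>1\<close>.
\<close>

lemma Sos_tilde_gaussian_approximation:
  fixes \<sigma> :: "((real^'n) \<times> (real^'n)) measure" and \<phi> :: "real^'d \<Rightarrow> 'n quot"
  assumes \<sigma>: "invariant_prob \<sigma>" and n3: "CARD('n) \<ge> 3" and \<Phi>: "evaluation_vector \<sigma> \<phi> \<Phi>"
    and \<tau>: "\<tau> > 0" and u: "\<phi> u \<in> Sos_tilde \<sigma>"
  defines "n \<equiv> real CARD('n)"
  defines "\<psi> \<equiv> \<lambda>q :: real^('n \<times> 'n)^('n \<times> 'n). (LINT z|\<sigma>. (\<tau>\<^sup>2 * (\<Sum>i\<in>UNIV. (q $ i \<bullet> tensor z)\<^sup>2)) *\<^sub>R \<Phi> z)"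
  shows "\<exists>q. (norm q)\<^sup>2 \<le> (n\<^sup>2 + n - 2) / \<tau>\<^sup>2 \<and>
    (\<integral>\<^sup>+g. ennreal ((norm (u - \<psi> (q + g)))\<^sup>2) \<partial>gaussian) \<le> ennreal (4 * \<tau>\<^sup>2 + 2 * n\<^sup>2 * \<tau> ^ 4)"
proof -
  interpret prob_space \<sigma> using \<sigma> by (simp add: invariant_prob_def)
  have cont: "continuous_on UNIV \<Phi>"
    and eval: "\<And>z u. z \<in> orthonormal_pairs \<Longrightarrow> quot_eval (\<phi> u) z = u \<bullet> \<Phi> z"
    and iso: "\<And>u v. (LINT z|\<sigma>. (u \<bullet> \<Phi> z) * (v \<bullet> \<Phi> z)) = u \<bullet> v"
    and mean: "(LINT z|\<sigma>. \<Phi> z) = 0"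
    using \<Phi> by (auto simp: evaluation_vector_def)
  obtain a :: "'n \<times> 'n \<Rightarrow> real^('n \<times> 'n)" where
    a: "\<And>z. z \<in> orthonormal_pairs \<Longrightarrow> u \<bullet> \<Phi> z + 1 = (\<Sum>i\<in>UNIV. (a i \<bullet> tensor z)\<^sup>2)"
    and norm_a: "(\<Sum>i\<in>UNIV. (norm (a i))\<^sup>2) \<le> n\<^sup>2 + n - 2"
    using Sos_tilde_representation[OF \<sigma> n3 u] eval by (auto simp: n_def)
  note int = integrable_invariant_prob[OF \<sigma>]
  let ?A = "\<lambda>z. \<Sum>i\<in>UNIV. (a i \<bullet> tensor z)\<^sup>2"
  have intA: "(LINT z|\<sigma>. ?A z) = 1"
  proof -
    have "(LINT z|\<sigma>. ?A z) = (LINT z|\<sigma>. u \<bullet> \<Phi> z + 1)"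
      by (intro Bochner_Integration.integral_cong) (auto simp: space_invariant_prob[OF \<sigma>] a)
    also have "\<dots> = u \<bullet> (LINT z|\<sigma>. \<Phi> z) + 1"
      by (simp add: int[OF cont] prob_space)
    finally show ?thesis by (simp add: mean)
  qed
  have u_eq: "u = (LINT z|\<sigma>. ?A z *\<^sub>R \<Phi> z)"
  proof -
    have "v \<bullet> (LINT z|\<sigma>. ?A z *\<^sub>R \<Phi> z) = v \<bullet> u" for v
    proof -
      have "v \<bullet> (LINT z|\<sigma>. ?A z *\<^sub>R \<Phi> z) = (LINT z|\<sigma>. v \<bullet> (?A z *\<^sub>R \<Phi> z))"
        by (intro integral_inner_right[symmetric] int continuous_intros cont)
      also have "\<dots> = (LINT z|\<sigma>. (u \<bullet> \<Phi> z) * (v \<bullet> \<Phi> z) + v \<bullet> \<Phi> z)"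
        by (intro Bochner_Integration.integral_cong)
          (auto simp: space_invariant_prob[OF \<sigma>] a[symmetric] algebra_simps)
      also have "\<dots> = u \<bullet> v + v \<bullet> (LINT z|\<sigma>. \<Phi> z)"
        by (subst Bochner_Integration.integral_add)
          (auto intro!: int continuous_intros cont simp: iso int[OF cont])
      finally show ?thesis by (simp add: mean inner_commute)
    qed
    then have "\<forall>v. v \<bullet> u = v \<bullet> (LINT z|\<sigma>. ?A z *\<^sub>R \<Phi> z)" by simp
    then show ?thesis by (simp only: vector_eq_ldot)
  qed
  define q :: "real^('n \<times> 'n)^('n \<times> 'n)" where "q = (\<chi> i. (1 / \<tau>) *\<^sub>R a i)"
  have "(norm q)\<^sup>2 = (\<Sum>i\<in>UNIV. (norm (a i))\<^sup>2) / \<tau>\<^sup>2"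
    using \<tau> unfolding power2_norm_eq_inner inner_vec_def[of q q]
    by (simp add: q_def sum_divide_distrib power2_eq_square)
  then have norm_q: "(norm q)\<^sup>2 \<le> (n\<^sup>2 + n - 2) / \<tau>\<^sup>2"
    using norm_a \<tau> by (simp add: divide_right_mono)
  \<comment> \<open>The deviation of the noisy sum of squares from its mean.\<close>
  define H where "H = (\<lambda>(g :: real^('n \<times> 'n)^('n \<times> 'n)) z. \<Sum>i\<in>UNIV. (2 * \<tau> * (a i \<bullet> tensor z)) * (g $ i \<bullet> tensor z)
      + \<tau>\<^sup>2 * ((g $ i \<bullet> tensor z)\<^sup>2 - 1))"
  have contH: "continuous_on UNIV (H g)" for g
    unfolding H_def by (intro continuous_intros)
  have "tensor \<in> borel_measurable \<sigma>"
    by (intro measurable_invariant_prob[OF \<sigma>] borel_measurable_continuous_onI continuous_intros)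
  then have [measurable]: "(\<lambda>x. tensor (snd x)) \<in> borel_measurable (borel \<Otimes>\<^sub>M \<sigma>)"
    by (rule measurable_compose[OF measurable_snd])
  have [measurable]: "(\<lambda>x. fst x $ i) \<in> borel_measurable (borel \<Otimes>\<^sub>M \<sigma>)"
    for i :: "'n \<times> 'n"
    by (intro measurable_compose[OF measurable_fst] borel_measurable_continuous_onI continuous_intros)
  have [measurable]: "(\<lambda>(g, z). ennreal ((H g z)\<^sup>2)) \<in> borel_measurable (gaussian \<Otimes>\<^sub>M \<sigma>)"
    unfolding H_def split_def by measurable
  have "sigma_finite_measure (gaussian :: (real^('n \<times> 'n)^('n \<times> 'n)) measure)" by unfold_locales
  then interpret pair: pair_sigma_finite "gaussian :: (real^('n \<times> 'n)^('n \<times> 'n)) measure" \<sigma>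
    by (intro pair_sigma_finite.intro) unfold_locales
  have err: "(norm (u - \<psi> (q + g)))\<^sup>2 \<le> (LINT z|\<sigma>. (H g z)\<^sup>2)" for g
  proof -
    have shift: "\<tau>\<^sup>2 * (\<Sum>i\<in>UNIV. ((q + g) $ i \<bullet> tensor z)\<^sup>2) = ?A z + (H g z + CARD('n \<times> 'n) * \<tau>\<^sup>2)" for z
    proof -
      have "\<tau>\<^sup>2 * ((q + g) $ i \<bullet> tensor z)\<^sup>2 = (a i \<bullet> tensor z)\<^sup>2 +
          ((2 * \<tau> * (a i \<bullet> tensor z)) * (g $ i \<bullet> tensor z) + \<tau>\<^sup>2 * ((g $ i \<bullet> tensor z)\<^sup>2 - 1) + \<tau>\<^sup>2)" for i
      proof -
        have "\<tau>\<^sup>2 * ((q + g) $ i \<bullet> tensor z)\<^sup>2 = (\<tau> * ((q + g) $ i \<bullet> tensor z))\<^sup>2"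
          by (simp add: power_mult_distrib)
        also have "\<tau> * ((q + g) $ i \<bullet> tensor z) = a i \<bullet> tensor z + \<tau> * (g $ i \<bullet> tensor z)"
          using \<tau> by (simp add: q_def inner_add_left algebra_simps)
        finally show ?thesis by (simp add: power2_eq_square algebra_simps)
      qed
      then show ?thesis
        by (simp add: H_def sum_distrib_left sum.distrib)
    qed
    have "\<psi> (q + g) = (LINT z|\<sigma>. ?A z *\<^sub>R \<Phi> z + (H g z *\<^sub>R \<Phi> z + (CARD('n \<times> 'n) * \<tau>\<^sup>2) *\<^sub>R \<Phi> z))"
      unfolding \<psi>_def shift scaleR_add_left ..
    also have "\<dots> = (LINT z|\<sigma>. ?A z *\<^sub>R \<Phi> z) + (LINT z|\<sigma>. H g z *\<^sub>R \<Phi> z + (CARD('n \<times> 'n) * \<tau>\<^sup>2) *\<^sub>R \<Phi> z)"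
      by (intro Bochner_Integration.integral_add int continuous_intros cont contH)
    also have "(LINT z|\<sigma>. H g z *\<^sub>R \<Phi> z + (CARD('n \<times> 'n) * \<tau>\<^sup>2) *\<^sub>R \<Phi> z) =
        (LINT z|\<sigma>. H g z *\<^sub>R \<Phi> z) + (LINT z|\<sigma>. (CARD('n \<times> 'n) * \<tau>\<^sup>2) *\<^sub>R \<Phi> z)"
      by (intro Bochner_Integration.integral_add int continuous_intros cont contH)
    finally have "u - \<psi> (q + g) = - (LINT z|\<sigma>. H g z *\<^sub>R \<Phi> z)"
      by (simp add: mean flip: u_eq)
    then show ?thesis
      using evaluation_vector_Bessel[OF \<sigma> \<Phi> contH[of g]] by simp
  qed
  have "(\<integral>\<^sup>+g. ennreal ((norm (u - \<psi> (q + g)))\<^sup>2) \<partial>gaussian) \<le>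
      (\<integral>\<^sup>+g. (\<integral>\<^sup>+z. ennreal ((H g z)\<^sup>2) \<partial>\<sigma>) \<partial>gaussian)"
  proof (rule nn_integral_mono)
    fix g
    have "(\<integral>\<^sup>+z. ennreal ((H g z)\<^sup>2) \<partial>\<sigma>) = ennreal (LINT z|\<sigma>. (H g z)\<^sup>2)"
      by (intro nn_integral_eq_integral int continuous_intros contH) auto
    then show "ennreal ((norm (u - \<psi> (q + g)))\<^sup>2) \<le> (\<integral>\<^sup>+z. ennreal ((H g z)\<^sup>2) \<partial>\<sigma>)"
      using err[of g] by (simp add: ennreal_leI)
  qed
  also have "\<dots> = (\<integral>\<^sup>+z. (\<integral>\<^sup>+g. ennreal ((H g z)\<^sup>2) \<partial>gaussian) \<partial>\<sigma>)"
    by (rule pair.Fubini'[symmetric]) measurable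
  also have "\<dots> = (\<integral>\<^sup>+z. ennreal (4 * \<tau>\<^sup>2 * ?A z + 2 * n\<^sup>2 * \<tau> ^ 4) \<partial>\<sigma>)"
  proof (rule nn_integral_cong)
    fix z assume "z \<in> space \<sigma>"
    then have "norm (tensor z) = 1"
      by (auto simp: space_invariant_prob[OF \<sigma>] orthonormal_pairs_def norm_tensor)
    then have t: "tensor z \<bullet> tensor z = 1" by (simp add: dot_square_norm)
    have "has_bochner_integral gaussian
      (\<lambda>g. (\<Sum>i\<in>UNIV. (2 * \<tau> * (a i \<bullet> tensor z)) * (g \<bullet> axis i (tensor z)) + \<tau>\<^sup>2 * ((g \<bullet> axis i (tensor z))\<^sup>2 - 1))\<^sup>2)
      ((\<Sum>i\<in>UNIV. (2 * \<tau> * (a i \<bullet> tensor z))\<^sup>2) + 2 * (\<tau>\<^sup>2)\<^sup>2 * real (card (UNIV :: ('n \<times> 'n) set)))"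
      by (intro gaussian_chaos_second_moment) (auto simp: inner_axis_axis t)
    moreover have "(\<Sum>i\<in>UNIV. (2 * \<tau> * (a i \<bullet> tensor z))\<^sup>2) + 2 * (\<tau>\<^sup>2)\<^sup>2 * real (card (UNIV :: ('n \<times> 'n) set))
        = 4 * \<tau>\<^sup>2 * ?A z + 2 * n\<^sup>2 * \<tau> ^ 4"
      by (simp add: power_mult_distrib sum_distrib_left n_def power2_eq_square[of "real _"])
    ultimately have "has_bochner_integral gaussian (\<lambda>g. (H g z)\<^sup>2) (4 * \<tau>\<^sup>2 * ?A z + 2 * n\<^sup>2 * \<tau> ^ 4)"
      by (simp add: H_def inner_axis)
    then show "(\<integral>\<^sup>+g. ennreal ((H g z)\<^sup>2) \<partial>gaussian) = ennreal (4 * \<tau>\<^sup>2 * ?A z + 2 * n\<^sup>2 * \<tau> ^ 4)"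
      by (subst nn_integral_eq_integral) (auto simp: has_bochner_integral_iff)
  qed
  also have "\<dots> = ennreal (LINT z|\<sigma>. 4 * \<tau>\<^sup>2 * ?A z + 2 * n\<^sup>2 * \<tau> ^ 4)"
    by (intro nn_integral_eq_integral int continuous_intros) (auto intro!: add_nonneg_nonneg mult_nonneg_nonneg sum_nonneg)
  also have "(LINT z|\<sigma>. 4 * \<tau>\<^sup>2 * ?A z + 2 * n\<^sup>2 * \<tau> ^ 4) = 4 * \<tau>\<^sup>2 * (LINT z|\<sigma>. ?A z) + 2 * n\<^sup>2 * \<tau> ^ 4"
    by (subst Bochner_Integration.integral_add)
      (auto intro!: int continuous_intros simp: prob_space)
  finally show ?thesis
    using norm_q by (auto simp: intA)
qed

lemma measurable_gaussian_approximation: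
  fixes \<sigma> :: "((real^'n) \<times> (real^'n)) measure" and \<phi> :: "real^'d \<Rightarrow> 'n quot"
  assumes \<sigma>: "invariant_prob \<sigma>" and \<Phi>: "evaluation_vector \<sigma> \<phi> \<Phi>"
  shows "(\<lambda>q :: real^('n \<times> 'n)^('n \<times> 'n). (LINT z|\<sigma>. (c * (\<Sum>i\<in>UNIV. (q $ i \<bullet> tensor z)\<^sup>2)) *\<^sub>R \<Phi> z))
    \<in> borel_measurable borel"
proof -
  interpret prob_space \<sigma> using \<sigma> by (simp add: invariant_prob_def)
  have "tensor \<in> borel_measurable \<sigma>" "\<Phi> \<in> borel_measurable \<sigma>"
    using \<Phi> unfolding evaluation_vector_def
    by (auto intro!: measurable_invariant_prob[OF \<sigma>] borel_measurable_continuous_onI continuous_intros)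
  then have [measurable]: "(\<lambda>x. tensor (snd x)) \<in> borel_measurable (borel \<Otimes>\<^sub>M \<sigma>)"
    "(\<lambda>x. \<Phi> (snd x)) \<in> borel_measurable (borel \<Otimes>\<^sub>M \<sigma>)"
    by (auto intro: measurable_compose[OF measurable_snd])
  have [measurable]: "(\<lambda>x. fst x $ i) \<in> borel_measurable (borel \<Otimes>\<^sub>M \<sigma>)"
    for i :: "'n \<times> 'n"
    by (intro measurable_compose[OF measurable_fst] borel_measurable_continuous_onI continuous_intros)
  show ?thesis by measurable
qed

section \<open>The volume bound\<close>

text \<open>
  The ball contains the inscribed cube.
\<close>

lemma measure_unit_ball_ge:
  "(2 / sqrt (DIM('a))) ^ DIM('a) \<le> measure lebesgue (cball (0 :: 'a::euclidean_space) 1)"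
proof -
  define r where "r = 1 / sqrt (DIM('a))"
  have r: "r > 0" by (simp add: r_def)
  have "cbox (- (r *\<^sub>R One)) (r *\<^sub>R One) \<subseteq> cball (0 :: 'a) 1"
  proof
    fix x :: 'a assume "x \<in> cbox (- (r *\<^sub>R One)) (r *\<^sub>R One)"
    then have "\<bar>x \<bullet> b\<bar> \<le> r" if "b \<in> Basis" for b
      using that by (auto simp: mem_box abs_le_iff)
    then have "(\<Sum>b\<in>Basis. (x \<bullet> b) * (x \<bullet> b)) \<le> (\<Sum>b\<in>(Basis :: 'a set). r * r)"
      using r by (intro sum_mono) (metis abs_mult_self_eq mult_mono abs_ge_zero less_imp_le)
    also have "\<dots> = 1" by (simp add: r_def)
    finally show "x \<in> cball 0 1"
      unfolding euclidean_inner[symmetric] by (simp add: dot_square_norm abs_square_le_1)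
  qed
  then have "measure lebesgue (cbox (- (r *\<^sub>R One)) (r *\<^sub>R (One :: 'a))) \<le> measure lebesgue (cball (0 :: 'a) 1)"
    by (intro measure_mono_fmeasurable) auto
  also have "measure lebesgue (cbox (- (r *\<^sub>R One)) (r *\<^sub>R (One :: 'a))) = (2 * r) ^ DIM('a)"
  proof -
    have "measure lebesgue (cbox (- (r *\<^sub>R One)) (r *\<^sub>R (One :: 'a))) =
        measure lborel (cbox (- (r *\<^sub>R One)) (r *\<^sub>R (One :: 'a)))"
      by (rule measure_completion) simp
    also have "\<dots> = (2 * r) ^ DIM('a)"
      using r by (subst content_cbox) (auto simp: inner_diff_left)
    finally show ?thesis .
  qed
  finally show ?thesis by (simp add: r_def)
qed

lemma dim_M_eq:
  assumes "m \<ge> 3"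
  shows "4 * real (dim_M m) = (real m ^ 2 + real m - 2)\<^sup>2 + 4 * real m - 8"
proof -
  have "2 * ((m + 1) choose 2) = m * (m + 1)"
    by (simp add: choose_two)
  then have c: "real ((m + 1) choose 2) = real m * (real m + 1) / 2"
    by (metis nonzero_mult_div_cancel_left of_nat_1 of_nat_add of_nat_mult of_nat_numeral zero_neq_numeral)
  have "m + 1 \<le> (m + 1) choose 2"
    using assms \<open>2 * ((m + 1) choose 2) = m * (m + 1)\<close> mult_right_mono[of 2 m "m + 1"] by simp
  then have "(m + 1)\<^sup>2 \<le> ((m + 1) choose 2)\<^sup>2" by (rule power_mono) simp
  then have "m\<^sup>2 + 1 \<le> ((m + 1) choose 2)\<^sup>2" by (simp add: power2_eq_square)
  then have "real (dim_M m) = (real ((m + 1) choose 2))\<^sup>2 - (real m)\<^sup>2 - 1"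
    unfolding dim_M_def by (simp add: of_nat_diff)
  then show ?thesis unfolding c by (simp add: power2_eq_square field_simps)
qed

text \<open>
  The noise level \<open>\<tau>\<close> is chosen such that the translations have squared length at most
  \<open>(n\<^sup>2 + n - 2) / \<tau>\<^sup>2 = D\<close>. The dimension \<open>D\<close> is at least \<open>(n\<^sup>2 + n - 2)\<^sup>2 / 4\<close>, so \<open>\<tau>\<close> is at most \<open>2 / n\<close>
  and the error \<open>\<rho>\<close> at most \<open>sqrt 48 / n\<close>. The quotient of volumes, to the power \<open>1 / D\<close>, is thus at most
  \<open>sqrt (2 * pi / D) * exp 1 * \<rho> * sqrt D / 2\<close>, which is below the claimed bound.
\<close>

theorem theorem4p6:
  fixes \<sigma> :: "((real^'n) \<times> (real^'n)) measure"
    and \<phi> :: "real^'d \<Rightarrow> 'n quot"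
  assumes "CARD('n) \<ge> 3"
    and "invariant_prob \<sigma>"
    and "CARD('d) = dim_M CARD('n)"
    and "linear_isometry_M \<sigma> \<phi>"
  shows "(Vol \<phi> (Sos_tilde \<sigma>) / Vol \<phi> (unit_ball_M \<sigma>)) powr (1 / real (dim_M CARD('n)))
           \<le> 2^3 * 3 * 6 powr (1/2) * (1 / real CARD('n))"
proof -
  define n where "n = real CARD('n)"
  define D where "D = real CARD('d)"
  define L where "L = n\<^sup>2 + n - 2"
  have n: "n \<ge> 3" using assms(1) by (simp add: n_def)
  have L: "n\<^sup>2 \<le> L" using n by (simp add: L_def)
  moreover have "0 < n\<^sup>2" using n by simp
  ultimately have L_pos: "0 < L" by linarith
  note L = L L_pos
  have D4: "4 * D = L\<^sup>2 + 4 * n - 8"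
    using dim_M_eq[OF assms(1)] by (simp add: D_def L_def n_def assms(3))
  have D: "D > 0" by (simp add: D_def)
  define \<tau> where "\<tau> = sqrt (L / D)"
  have \<tau>: "\<tau> > 0" using L D by (simp add: \<tau>_def)
  have \<tau>2: "\<tau>\<^sup>2 = L / D" using L D by (simp add: \<tau>_def)
  have \<tau>n: "\<tau>\<^sup>2 \<le> 4 / n\<^sup>2"
  proof -
    have "L * n\<^sup>2 \<le> L * L" using L by (intro mult_left_mono) auto
    also have "\<dots> \<le> 4 * D" using D4 n by (simp add: power2_eq_square)
    finally show ?thesis using D n by (simp add: \<tau>2 field_simps)
  qed
  define \<rho> where "\<rho> = sqrt (4 * \<tau>\<^sup>2 + 2 * n\<^sup>2 * \<tau> ^ 4)"
  have \<rho>: "\<rho> > 0" using \<tau> by (simp add: \<rho>_def add_pos_nonneg)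
  have \<rho>2: "\<rho>\<^sup>2 = 4 * \<tau>\<^sup>2 + 2 * n\<^sup>2 * \<tau> ^ 4" using \<tau> by (simp add: \<rho>_def)
  have \<rho>n: "\<rho>\<^sup>2 \<le> 48 / n\<^sup>2"
  proof -
    have "\<tau> ^ 4 = \<tau>\<^sup>2 * \<tau>\<^sup>2" by (simp add: power2_eq_square power4_eq_xxxx)
    also have "\<dots> \<le> (4 / n\<^sup>2) * (4 / n\<^sup>2)" by (intro mult_mono \<tau>n) auto
    finally have "2 * n\<^sup>2 * \<tau> ^ 4 \<le> 2 * n\<^sup>2 * ((4 / n\<^sup>2) * (4 / n\<^sup>2))" by (intro mult_left_mono) auto
    also have "\<dots> = 32 / n\<^sup>2" using n by (simp add: power2_eq_square)
    finally show ?thesis using \<tau>n by (simp add: \<rho>2)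
  qed
  obtain \<Phi> where \<Phi>: "evaluation_vector \<sigma> \<phi> \<Phi>" using evaluation_vector_exists[OF assms(2,4)] by blast
  define c where "c = sqrt (2 * pi / D) * exp 1 * \<rho>"
  have c: "c > 0" using D \<rho> by (simp add: c_def)
  have vol: "Vol \<phi> (Sos_tilde \<sigma>) \<le> c ^ CARD('d)"
  \<comment> \<open>The measure of a set that is not measurable is zero by convention, and the bound is then trivial.\<close>
  proof (cases "\<phi> -` Sos_tilde \<sigma> \<in> sets lebesgue")
    case True
    have "emeasure lebesgue (\<phi> -` Sos_tilde \<sigma>) \<le> ennreal ((sqrt (2 * pi / DIM(real^'d)) * exp 1 * \<rho>) ^ DIM(real^'d))"
    proof (rule emeasure_le_of_gaussian_approximation[OF True measurable_gaussian_approximation[OF assms(2) \<Phi>, of "\<tau>\<^sup>2"] \<rho>])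
      fix u assume "u \<in> \<phi> -` Sos_tilde \<sigma>"
      then have u: "\<phi> u \<in> Sos_tilde \<sigma>" by simp
      have "L / \<tau>\<^sup>2 = DIM(real^'d)" using L D by (simp add: \<tau>2 D_def)
      then show "\<exists>q :: real^('n \<times> 'n)^('n \<times> 'n). (norm q)\<^sup>2 \<le> DIM(real^'d) \<and>
        (\<integral>\<^sup>+g. ennreal ((norm (u - (LINT z|\<sigma>. (\<tau>\<^sup>2 * (\<Sum>i\<in>UNIV. ((q + g) $ i \<bullet> tensor z)\<^sup>2)) *\<^sub>R \<Phi> z)))\<^sup>2) \<partial>gaussian)
          \<le> ennreal (\<rho>\<^sup>2)"
        using Sos_tilde_gaussian_approximation[OF assms(2,1) \<Phi> \<tau> u]
        unfolding \<rho>2 L_def n_def by (simp only:)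
    qed
    then show ?thesis
      unfolding Vol_def measure_def using c by (simp add: c_def D_def enn2real_leI)
  next
    case False
    then show ?thesis
      using c by (simp add: Vol_def measure_notin_sets)
  qed
  have "\<phi> -` unit_ball_M \<sigma> = cball 0 1"
    using assms(4)
    by (auto simp: unit_ball_M_def linear_isometry_M_def dot_square_norm abs_square_le_1)
  then have ball: "(2 / sqrt D) ^ CARD('d) \<le> Vol \<phi> (unit_ball_M \<sigma>)"
    using measure_unit_ball_ge[where 'a = "real^'d"] by (simp add: Vol_def D_def)
  have "Vol \<phi> (Sos_tilde \<sigma>) / Vol \<phi> (unit_ball_M \<sigma>) \<le> c ^ CARD('d) / (2 / sqrt D) ^ CARD('d)"
    using vol ball c D by (intro frac_le) auto
  also have "\<dots> = (c * sqrt D / 2) ^ CARD('d)" by (simp add: power_divide power_mult_distrib)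
  finally have "(Vol \<phi> (Sos_tilde \<sigma>) / Vol \<phi> (unit_ball_M \<sigma>)) powr (1 / D) \<le> ((c * sqrt D / 2) ^ CARD('d)) powr (1 / D)"
    using D by (intro powr_mono2) (auto simp: Vol_def)
  also have "\<dots> = c * sqrt D / 2"
    using c D by (simp add: D_def powr_realpow[symmetric] powr_powr)
  also have "\<dots> \<le> 24 * sqrt 6 / n"
  proof (rule power2_le_imp_le)
    have "(c * sqrt D / 2)\<^sup>2 = pi * (exp 1 * exp 1) * \<rho>\<^sup>2 / 2"
      using D by (simp add: c_def power_mult_distrib power_divide power2_eq_square[of "exp 1"])
    also have "\<dots> \<le> 4 * (3 * 3) * (48 / n\<^sup>2) / 2"
      using pi_less_4 exp_le by (intro divide_right_mono mult_mono \<rho>n) auto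
    also have "\<dots> \<le> (24 * sqrt 6 / n)\<^sup>2"
      using n by (simp add: power_divide power_mult_distrib divide_right_mono)
    finally show "(c * sqrt D / 2)\<^sup>2 \<le> (24 * sqrt 6 / n)\<^sup>2" .
  qed (use n in auto)
  finally show ?thesis
    by (simp add: D_def n_def assms(3) powr_half_sqrt)
qed

end
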